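(* Let $C=\{f(z,w)=0\}\subset(\mathbb C^* )^2$ be a smooth curve, $\Sigma=\operatorname{Crit}(\operatorname{Log}|_C)$, $h=\operatorname{Log}|_\Sigma$ and $\mathcal{CA}_C=h(\Sigma)$. Assume local properness of $h$ near each contour point under consideration and finite critical fibers $h^{-1}(p)$. Then every singular point $p$ of $\mathcal{CA}_C$ is obtained from one of the following explicit real systems, i.e. $p=\left(\tfrac12\log R,\tfrac12\log S\right)$ where $(R,S)=(|z|^2,|w|^2)$ for a real solution of one of: (1) the critical equations $u=v=\rho=0$ together with the vanishing of all $3\times3$ minors of $DG$; (2) the critical equations $u=v=\rho=0$ together with $\widetilde J_z=\widetilde J_w=0$; (3) the saturated two-lift system: $u=v=\rho=0$ at $q=(x,y,s,t)$, $u'=v'=\rho'=0$ at $q'=(x',y',s',t')$, $x^2+y^2=(x')^2+(y')^2$, $s^2+t^2=(s')^2+(t')^2$, and $q\ne q'$. Suppose in addition that every pair of distinct nondegenerate critical lifts over the same logarithmic point determines distinct local contour branches, and that every projected degenerate lift has a singular image germ, i.e. for every $(R,S)$ in the exact projection of systems (1) and (2) the germ of $\mathcal{CA}_C$ at $\left(\tfrac12\log R,\tfrac12\log S\right)$ is not a smooth embedded curve germ. Let $E\subset\mathbb R_{>0}^2$ be the union of the exact positive real projections of systems (1), (2), (3) to $(R,S)$. Then $$\operatorname{Sing}(\mathcal{CA}_C)=\left\{\left(\tfrac12\log R,\tfrac12\log S\right)\ :\ (R,S)\in E\right\}.$$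
   Context: $f\in\mathbb C[z^{\pm1},w^{\pm1}]$, and $C=\{f=0\}\subset(\mathbb C^* )^2$ is smooth: $f_z,f_w$ do not vanish simultaneously at any point of $C$. $\operatorname{Log}(z,w)=(\log|z|,\log|w|)$. $\operatorname{Crit}(\operatorname{Log}|_C)$ is the set of points of $C$ where the real differential of $\operatorname{Log}|_C:C\to\mathbb R^2$ has rank less than $2$. $\mathcal{CA}_C=h(\Sigma)$ is the contour of the amoeba of $C$. A point $p\in\mathcal{CA}_C$ is regular if there is an open neighborhood $W$ of $p$ in $\mathbb R^2$ such that $W\cap\mathcal{CA}_C$ is a smooth embedded real curve; $\operatorname{Sing}(\mathcal{CA}_C)$ is the complement in $\mathcal{CA}_C$ of the set of regular points. Local properness at $p\in\mathcal{CA}_C$ is understood germwise: there are neighborhoods $W$ of $p$ in $\mathbb R^2$ and $\Omega$ of $h^{-1}(p)$ in $\Sigma$ such that $h|_\Omega:\Omega\to W$ is proper and, after possibly shrinking $W$, every point of $\Sigma$ mapped into $W$ belongs to $\Omega$. Write $z=x+iy$, $w=s+it$, $u=\operatorname{Re}f$, $v=\operatorname{Im}f$, $A=zf_z$, $B=wf_w$, $\rho=\operatorname{Im}(A\overline B)$; Laurent denominators may be cleared without changing zero sets in $(\mathbb C^* )^2$. $A$ and $B$ do not vanish simultaneously on $C$, so the charts $\{A\ne0\}$ and $\{B\ne0\}$ cover $C$; on each chart $\Sigma$ is given by $u=v=\rho=0$. $G=(u,v,\rho)$ and $DG$ is its $3\times4$ real Jacobian with respect to $(x,y,s,t)$. Let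 $\alpha=\left(\frac{x}{x^2+y^2},\frac{y}{x^2+y^2},0,0\right)$, $\beta=\left(0,0,\frac{s}{s^2+t^2},\frac{t}{s^2+t^2}\right)$ be the rows of $D\operatorname{Log}$, $J_z=\det\begin{pmatrix}DG\\ \alpha\end{pmatrix}$, $J_w=\det\begin{pmatrix}DG\\ \beta\end{pmatrix}$, $\widetilde J_z=(x^2+y^2)J_z$, $\widetilde J_w=(s^2+t^2)J_w$. Primed functions denote evaluation at $q'$. Solutions are real solutions with $z,w$ (and $z',w'$) nonzero, taken over both charts $A\neq0$ and $B\neq0$ (chosen independently for $q$ and $q'$). "Saturated two-lift system" means the actual real locus with $q\ne q'$, not a Zariski closure. The exact positive real projection of a system is the set of $(R,S)\in\mathbb R_{>0}^2$ with $R=x^2+y^2$, $S=s^2+t^2$ for an actual real solution of the system (not the zero set of an elimination ideal). A critical lift over $p$ is a point $q\in\Sigma$ with $h(q)=p$; it is nondegenerate if $\Sigma$ is smooth at $q$ and $dh_q\ne0$, and its local contour branch is the germ at $p$ of $h(U)$ for a small neighborhood $U$ of $q$ in $\Sigma$. *)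

theory Defs
  imports "HOL-Analysis.Analysis" "HOL-Library.Poly_Mapping"
begin

text \<open>\<open>C\<^sup>\<infinity>\<close> on an open set of parameters: \<open>D n\<close> is the \<open>n\<close>-th derivative of the path.\<close>

definition smooth_path_on :: "(real \<Rightarrow> 'a::euclidean_space) \<Rightarrow> real set \<Rightarrow> bool" where
  "smooth_path_on \<gamma> I \<longleftrightarrow>
     (\<exists>D :: nat \<Rightarrow> real \<Rightarrow> 'a. D 0 = \<gamma> \<and>
        (\<forall>n. \<forall>t\<in>I. (D n has_vector_derivative D (Suc n) t) (at t)))"

text \<open>Embedded one-dimensional \<open>C\<^sup>\<infinity>\<close> submanifold, by regular local parametrizations that are
  homeomorphisms onto relatively open pieces.\<close>

definition smooth_embedded_curve :: "'a::euclidean_space set \<Rightarrow> bool" where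
  "smooth_embedded_curve X \<longleftrightarrow>
     (\<forall>x\<in>X. \<exists>V a b \<gamma> g. open V \<and> x \<in> V \<and> smooth_path_on \<gamma> {a<..<b} \<and>
        (\<forall>t\<in>{a<..<b}. vector_derivative \<gamma> (at t) \<noteq> 0) \<and>
        homeomorphism {a<..<b} (X \<inter> V) \<gamma> g)"

definition smooth_curve_near :: "'a::euclidean_space set \<Rightarrow> 'a \<Rightarrow> bool" where
  "smooth_curve_near X x \<longleftrightarrow> (\<exists>W. open W \<and> x \<in> W \<and> smooth_embedded_curve (W \<inter> X))"

text \<open>Velocities at \<open>x\<close> of smooth paths in \<open>X\<close> through \<open>x\<close>; this is the usual tangent space when
  \<open>X\<close> is an embedded submanifold near \<open>x\<close>.\<close>

definition tangent_vectors :: "'a::euclidean_space set \<Rightarrow> 'a \<Rightarrow> 'a set" where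
  "tangent_vectors X x =
     {v. \<exists>\<gamma> \<epsilon>. \<epsilon> > 0 \<and> smooth_path_on \<gamma> {-\<epsilon><..<\<epsilon>} \<and> \<gamma> ` {-\<epsilon><..<\<epsilon>} \<subseteq> X \<and>
            \<gamma> 0 = x \<and> (\<gamma> has_vector_derivative v) (at 0)}"

definition set_germ :: "'a::topological_space \<Rightarrow> 'a set \<Rightarrow> 'a set set" where
  "set_germ p X = {Y. \<exists>W. open W \<and> p \<in> W \<and> W \<inter> X = W \<inter> Y}"

text \<open>A finitely supported coefficient function on exponent pairs is a Laurent polynomial in
  \<open>z\<close> and \<open>w\<close>.\<close>

type_synonym laurent = "(int \<times> int) \<Rightarrow>\<^sub>0 complex"

definition leval :: "laurent \<Rightarrow> complex \<Rightarrow> complex \<Rightarrow> complex" where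
  "leval f z w = (\<Sum>k\<in>Poly_Mapping.keys f. Poly_Mapping.lookup f k * z powi fst k * w powi snd k)"

definition ldz :: "laurent \<Rightarrow> complex \<Rightarrow> complex \<Rightarrow> complex" where
  "ldz f z w = deriv (\<lambda>\<zeta>. leval f \<zeta> w) z"

definition ldw :: "laurent \<Rightarrow> complex \<Rightarrow> complex \<Rightarrow> complex" where
  "ldw f z w = deriv (\<lambda>\<omega>. leval f z \<omega>) w"

definition curve :: "laurent \<Rightarrow> (complex \<times> complex) set" where
  "curve f = {(z, w). z \<noteq> 0 \<and> w \<noteq> 0 \<and> leval f z w = 0}"

definition smooth_curve :: "laurent \<Rightarrow> bool" where
  "smooth_curve f \<longleftrightarrow> (\<forall>(z, w)\<in>curve f. \<not> (ldz f z w = 0 \<and> ldw f z w = 0))"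

definition Log :: "complex \<times> complex \<Rightarrow> real \<times> real" where
  "Log = (\<lambda>(z, w). (ln (cmod z), ln (cmod w)))"

abbreviation dLog :: "complex \<times> complex \<Rightarrow> complex \<times> complex \<Rightarrow> real \<times> real" where
  "dLog q \<equiv> frechet_derivative Log (at q)"

definition Crit :: "laurent \<Rightarrow> (complex \<times> complex) set" where
  "Crit f = {q \<in> curve f. dim (dLog q ` tangent_vectors (curve f) q) < 2}"

definition contour :: "laurent \<Rightarrow> (real \<times> real) set" where
  "contour f = Log ` Crit f"

definition Sing_contour :: "laurent \<Rightarrow> (real \<times> real) set" where
  "Sing_contour f = {p \<in> contour f. \<not> smooth_curve_near (contour f) p}"

definition crit_fiber :: "laurent \<Rightarrow> real \<times> real \<Rightarrow> (complex \<times> complex) set" where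
  "crit_fiber f p = {q \<in> Crit f. Log q = p}"

definition locally_proper_at :: "laurent \<Rightarrow> real \<times> real \<Rightarrow> bool" where
  "locally_proper_at f p \<longleftrightarrow>
     (\<exists>W \<Omega>. open W \<and> p \<in> W \<and>
        openin (top_of_set (Crit f)) \<Omega> \<and> crit_fiber f p \<subseteq> \<Omega> \<and>
        proper_map (top_of_set \<Omega>) (top_of_set W) Log \<and>
        (\<exists>W'. open W' \<and> p \<in> W' \<and> W' \<subseteq> W \<and> (\<forall>q\<in>Crit f. Log q \<in> W' \<longrightarrow> q \<in> \<Omega>)))"

definition nondegenerate_lift :: "laurent \<Rightarrow> complex \<times> complex \<Rightarrow> bool" where
  "nondegenerate_lift f q \<longleftrightarrow>
     q \<in> Crit f \<and> smooth_curve_near (Crit f) q \<and>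
     (\<exists>v\<in>tangent_vectors (Crit f) q. dLog q v \<noteq> 0)"

text \<open>The common germ at \<open>Log q\<close> of the images of all sufficiently small neighborhoods of \<open>q\<close> in
  the critical locus. It is meaningful at nondegenerate lifts, where the critical locus is mapped
  homeomorphically onto its image near \<open>q\<close>.\<close>

definition contour_branch :: "laurent \<Rightarrow> complex \<times> complex \<Rightarrow> (real \<times> real) set set" where
  "contour_branch f q =
     (THE g. \<exists>U\<^sub>0. open U\<^sub>0 \<and> q \<in> U\<^sub>0 \<and>
        (\<forall>U. open U \<and> q \<in> U \<and> U \<subseteq> U\<^sub>0 \<longrightarrow> set_germ (Log q) (Log ` (U \<inter> Crit f)) = g))"

text \<open>Real coordinates are \<open>(x, y, s, t) = (q $ 1, q $ 2, q $ 3, q $ 4)\<close>.\<close>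

definition zc :: "real^4 \<Rightarrow> complex" where
  "zc q = Complex (q $ 1) (q $ 2)"

definition wc :: "real^4 \<Rightarrow> complex" where
  "wc q = Complex (q $ 3) (q $ 4)"

definition Afun :: "laurent \<Rightarrow> real^4 \<Rightarrow> complex" where
  "Afun f q = zc q * ldz f (zc q) (wc q)"

definition Bfun :: "laurent \<Rightarrow> real^4 \<Rightarrow> complex" where
  "Bfun f q = wc q * ldw f (zc q) (wc q)"

definition ufun :: "laurent \<Rightarrow> real^4 \<Rightarrow> real" where
  "ufun f q = Re (leval f (zc q) (wc q))"

definition vfun :: "laurent \<Rightarrow> real^4 \<Rightarrow> real" where
  "vfun f q = Im (leval f (zc q) (wc q))"

definition rho :: "laurent \<Rightarrow> real^4 \<Rightarrow> real" where
  "rho f q = Im (Afun f q * cnj (Bfun f q))"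

definition G :: "laurent \<Rightarrow> real^4 \<Rightarrow> real^3" where
  "G f q = vector [ufun f q, vfun f q, rho f q]"

definition DG :: "laurent \<Rightarrow> real^4 \<Rightarrow> real^4^3" where
  "DG f q = jacobian (G f) (at q)"

definition Rsq :: "real^4 \<Rightarrow> real" where
  "Rsq q = (q $ 1)\<^sup>2 + (q $ 2)\<^sup>2"

definition Ssq :: "real^4 \<Rightarrow> real" where
  "Ssq q = (q $ 3)\<^sup>2 + (q $ 4)\<^sup>2"

definition alpha_row :: "real^4 \<Rightarrow> real^4" where
  "alpha_row q = vector [q $ 1 / Rsq q, q $ 2 / Rsq q, 0, 0]"

definition beta_row :: "real^4 \<Rightarrow> real^4" where
  "beta_row q = vector [0, 0, q $ 3 / Ssq q, q $ 4 / Ssq q]"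

definition append_row :: "real^4^3 \<Rightarrow> real^4 \<Rightarrow> real^4^4" where
  "append_row M r = vector [M $ 1, M $ 2, M $ 3, r]"

definition Jz :: "laurent \<Rightarrow> real^4 \<Rightarrow> real" where
  "Jz f q = det (append_row (DG f q) (alpha_row q))"

definition Jw :: "laurent \<Rightarrow> real^4 \<Rightarrow> real" where
  "Jw f q = det (append_row (DG f q) (beta_row q))"

definition Jz_tilde :: "laurent \<Rightarrow> real^4 \<Rightarrow> real" where
  "Jz_tilde f q = Rsq q * Jz f q"

definition Jw_tilde :: "laurent \<Rightarrow> real^4 \<Rightarrow> real" where
  "Jw_tilde f q = Ssq q * Jw f q"

text \<open>The disjunction is the union over the two charts.\<close>

definition crit_eqs :: "laurent \<Rightarrow> real^4 \<Rightarrow> bool" where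
  "crit_eqs f q \<longleftrightarrow>
     zc q \<noteq> 0 \<and> wc q \<noteq> 0 \<and> (Afun f q \<noteq> 0 \<or> Bfun f q \<noteq> 0) \<and>
     ufun f q = 0 \<and> vfun f q = 0 \<and> rho f q = 0"

text \<open>An injection \<open>\<sigma>\<close> selects three of the four columns; reordering them only changes the sign
  of the minor.\<close>

definition system1 :: "laurent \<Rightarrow> (real^4) set" where
  "system1 f = {q. crit_eqs f q \<and>
     (\<forall>\<sigma> :: 3 \<Rightarrow> 4. inj \<sigma> \<longrightarrow> det (\<chi> i j. DG f q $ i $ \<sigma> j) = 0)}"

definition system2 :: "laurent \<Rightarrow> (real^4) set" where
  "system2 f = {q. crit_eqs f q \<and> Jz_tilde f q = 0 \<and> Jw_tilde f q = 0}"

definition system3 :: "laurent \<Rightarrow> ((real^4) \<times> (real^4)) set" where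
  "system3 f = {(q, q'). crit_eqs f q \<and> crit_eqs f q' \<and> Rsq q = Rsq q' \<and> Ssq q = Ssq q' \<and> q \<noteq> q'}"

definition proj1 :: "laurent \<Rightarrow> (real \<times> real) set" where
  "proj1 f = (\<lambda>q. (Rsq q, Ssq q)) ` system1 f"

definition proj2 :: "laurent \<Rightarrow> (real \<times> real) set" where
  "proj2 f = (\<lambda>q. (Rsq q, Ssq q)) ` system2 f"

definition proj3 :: "laurent \<Rightarrow> (real \<times> real) set" where
  "proj3 f = (\<lambda>(q, q'). (Rsq q, Ssq q)) ` system3 f"

definition half_log :: "real \<times> real \<Rightarrow> real \<times> real" where
  "half_log = (\<lambda>(R, S). (1/2 * ln R, 1/2 * ln S))"

end

theory Submission
  imports Defs
begin

text \<open>
  In logarithmic coordinates \<open>(dz/z, dw/w)\<close> a tangent line of the curve is the complex line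
  \<open>A \<zeta> + B \<omega> = 0\<close>, and the differential of \<open>Log\<close> takes real parts. The real parts fill the plane
  unless \<open>A\<close> and \<open>B\<close> are linearly dependent over the reals, that is, unless \<open>\<rho> = Im (A cnj B)\<close>
  vanishes.
  Hence the critical locus is the real zero set of \<open>(u, v, \<rho>)\<close> (\<open>Crit_complex_coords_iff\<close>).

  Let \<open>q\<close> be a critical point off system (2), say with \<open>J\<^sub>z \<noteq> 0\<close>. Then \<open>(u, v, \<rho>, log |z|)\<close> are local
  coordinates at \<open>q\<close>, and near \<open>q\<close> the critical locus is the last coordinate line: a smooth arc with
  parameter \<open>log |z|\<close>, which \<open>Log\<close> therefore maps to an embedded arc
  (\<open>critical_arc_off_system2\<close>). If \<open>q\<close> is moreover the only critical point over its image \<open>p\<close>, then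
  local properness keeps all other critical points away from \<open>p\<close>, so the contour near \<open>p\<close> is this
  arc and \<open>p\<close> is regular. Contrapositively, a singular point has a lift in system (2) or two lifts,
  as in system (3) (\<open>singular_contour_point_in_systems\<close>).

  For the converse, points over systems (1) and (2) are singular by hypothesis. Suppose a point with
  two lifts off system (2) were regular. Each branch is an arc inside a one-dimensional curve, so by
  invariance of domain it fills the curve near the point. Both branches then equal the germ of the
  contour, contrary to the assumed distinctness (\<open>two_lifts_singular\<close>).

  Smooth curves are required to be \<open>C\<^sup>\<infinity>\<close>, while the inverse function theorem gives one derivative.
  The coordinate lines are, however, integral curves of vector fields whose components belong to a
  class of explicit functions closed under partial derivatives, and such curves have derivatives of
  every order (\<open>elementary_on_integral_curve\<close>, \<open>straightening_path\<close>).
\<close>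

section \<open>Elementary functions and their integral curves\<close>

text \<open>The functions built from coordinates by field operations and logarithms stand in for all smooth
  functions: they contain every function occurring in the systems, and partial derivatives stay
  inside the class. The rule \<open>cong\<close> makes only the values on \<open>U\<close> matter; it is needed because
  \<^const>\<open>ldz\<close> and \<^const>\<open>ldw\<close> agree with Laurent polynomials only where \<open>z\<close> and \<open>w\<close> are nonzero.\<close>

inductive elementary_on :: "(real^'n) set \<Rightarrow> (real^'n \<Rightarrow> real) \<Rightarrow> bool" for U where
  const: "elementary_on U (\<lambda>q. c)"
| coord: "elementary_on U (\<lambda>q. q $ i)"
| add: "elementary_on U g \<Longrightarrow> elementary_on U h \<Longrightarrow> elementary_on U (\<lambda>q. g q + h q)"
| mult: "elementary_on U g \<Longrightarrow> elementary_on U h \<Longrightarrow> elementary_on U (\<lambda>q. g q * h q)"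
| inverse: "elementary_on U g \<Longrightarrow> (\<And>q. q \<in> U \<Longrightarrow> g q \<noteq> 0) \<Longrightarrow> elementary_on U (\<lambda>q. inverse (g q))"
| ln: "elementary_on U g \<Longrightarrow> (\<And>q. q \<in> U \<Longrightarrow> 0 < g q) \<Longrightarrow> elementary_on U (\<lambda>q. ln (g q))"
| cong: "elementary_on U g \<Longrightarrow> (\<And>q. q \<in> U \<Longrightarrow> h q = g q) \<Longrightarrow> elementary_on U h"

lemma elementary_on_subset:
  assumes "elementary_on U g" "V \<subseteq> U"
  shows "elementary_on V g"
  using assms(1)
proof induction
  case (cong g h)
  show ?case
    by (rule elementary_on.cong[OF cong.IH]) (use cong.hyps assms(2) in blast)
qed (use assms(2) in \<open>auto intro: elementary_on.const elementary_on.coord elementary_on.add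
  elementary_on.mult elementary_on.inverse elementary_on.ln\<close>)

lemma elementary_on_uminus: "elementary_on U g \<Longrightarrow> elementary_on U (\<lambda>q. - g q)"
  using elementary_on.mult[OF elementary_on.const[of U "-1"], of g] by simp

lemma elementary_on_diff:
  "elementary_on U g \<Longrightarrow> elementary_on U h \<Longrightarrow> elementary_on U (\<lambda>q. g q - h q)"
  using elementary_on.add[OF _ elementary_on_uminus, of U g h] by simp

lemma elementary_on_divide:
  "elementary_on U g \<Longrightarrow> elementary_on U h \<Longrightarrow> (\<And>q. q \<in> U \<Longrightarrow> h q \<noteq> 0) \<Longrightarrow>
    elementary_on U (\<lambda>q. g q / h q)"
  unfolding divide_inverse by (intro elementary_on.mult elementary_on.inverse)

lemma elementary_on_sum:
  "(\<And>i. i \<in> I \<Longrightarrow> elementary_on U (g i)) \<Longrightarrow> elementary_on U (\<lambda>q. \<Sum>i\<in>I. g i q)"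
  by (induction I rule: infinite_finite_induct) (auto intro: elementary_on.const elementary_on.add)

lemma elementary_on_prod:
  "(\<And>i. i \<in> I \<Longrightarrow> elementary_on U (g i)) \<Longrightarrow> elementary_on U (\<lambda>q. \<Prod>i\<in>I. g i q)"
  by (induction I rule: infinite_finite_induct) (auto intro: elementary_on.const elementary_on.mult)

lemma elementary_on_det:
  fixes E :: "real^'n \<Rightarrow> real^'m^'m"
  assumes "\<And>i j. elementary_on U (\<lambda>q. E q $ i $ j)"
  shows "elementary_on U (\<lambda>q. det (E q))"
  unfolding det_def using assms
  by (intro elementary_on_sum elementary_on.mult elementary_on.const elementary_on_prod)

text \<open>Closure of the class under partial differentiation: this is what allows derivatives to be
  iterated without a bound on the order.\<close>

lemma elementary_on_has_derivative:
  assumes "elementary_on U g" "open U"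
  shows "\<exists>g'. (\<forall>i. elementary_on U (g' i)) \<and>
           (\<forall>q\<in>U. (g has_derivative (\<lambda>h. \<Sum>i\<in>UNIV. g' i q * h $ i)) (at q))"
  using assms(1)
proof induction
  case (const c)
  show ?case
    by (rule exI[of _ "\<lambda>i q. 0"]) (auto intro: elementary_on.const)
next
  case (coord i)
  have *: "(\<Sum>j\<in>UNIV. (if j = i then 1 else 0) * h $ j) = h $ i" for h :: "real^'a"
    by (simp add: if_distrib if_distribR cong: if_cong)
  show ?case
    by (rule exI[of _ "\<lambda>j q. if j = i then 1 else 0"])
      (auto simp: * intro: elementary_on.const bounded_linear_imp_has_derivative bounded_linear_vec_nth)
next
  case (add g h)
  then obtain g' h' where
    g': "\<And>i. elementary_on U (g' i)" "\<And>q. q \<in> U \<Longrightarrow> (g has_derivative (\<lambda>h. \<Sum>i\<in>UNIV. g' i q * h $ i)) (at q)"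
    and h': "\<And>i. elementary_on U (h' i)" "\<And>q. q \<in> U \<Longrightarrow> (h has_derivative (\<lambda>h. \<Sum>i\<in>UNIV. h' i q * h $ i)) (at q)"
    by blast
  show ?case
  proof (intro exI[of _ "\<lambda>i q. g' i q + h' i q"] conjI allI ballI)
    fix q assume "q \<in> U"
    from has_derivative_add[OF g'(2)[OF this] h'(2)[OF this]]
    show "((\<lambda>q. g q + h q) has_derivative (\<lambda>k. \<Sum>i\<in>UNIV. (g' i q + h' i q) * k $ i)) (at q)"
      by (simp add: sum.distrib distrib_right)
  next
    show "elementary_on U (\<lambda>q. g' i q + h' i q)" for i
      by (rule elementary_on.add[OF g'(1) h'(1)])
  qed
next
  case (mult g h)
  then obtain g' h' where
    g': "\<And>i. elementary_on U (g' i)" "\<And>q. q \<in> U \<Longrightarrow> (g has_derivative (\<lambda>h. \<Sum>i\<in>UNIV. g' i q * h $ i)) (at q)"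
    and h': "\<And>i. elementary_on U (h' i)" "\<And>q. q \<in> U \<Longrightarrow> (h has_derivative (\<lambda>h. \<Sum>i\<in>UNIV. h' i q * h $ i)) (at q)"
    by blast
  show ?case
  proof (intro exI[of _ "\<lambda>i q. g q * h' i q + g' i q * h q"] conjI allI ballI)
    fix q assume "q \<in> U"
    from has_derivative_mult[OF g'(2)[OF this] h'(2)[OF this]]
    show "((\<lambda>q. g q * h q) has_derivative (\<lambda>k. \<Sum>i\<in>UNIV. (g q * h' i q + g' i q * h q) * k $ i)) (at q)"
      by (simp add: sum.distrib distrib_right distrib_left sum_distrib_left sum_distrib_right mult_ac)
  next
    show "elementary_on U (\<lambda>q. g q * h' i q + g' i q * h q)" for i
      using mult.hyps by (intro elementary_on.add elementary_on.mult g'(1) h'(1))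
  qed
next
  case (inverse g)
  then obtain g' where
    g': "\<And>i. elementary_on U (g' i)" "\<And>q. q \<in> U \<Longrightarrow> (g has_derivative (\<lambda>h. \<Sum>i\<in>UNIV. g' i q * h $ i)) (at q)"
    by blast
  show ?case
  proof (intro exI[of _ "\<lambda>i q. (-1) * (inverse (g q) * g' i q * inverse (g q))"] conjI allI ballI)
    fix q assume "q \<in> U"
    from Deriv.has_derivative_inverse[OF inverse.hyps(2)[OF this] g'(2)[OF this]]
    show "((\<lambda>q. inverse (g q)) has_derivative
        (\<lambda>k. \<Sum>i\<in>UNIV. (-1) * (inverse (g q) * g' i q * inverse (g q)) * k $ i)) (at q)"
      by (simp add: sum_negf sum_distrib_left sum_distrib_right mult_ac)
  next
    show "elementary_on U (\<lambda>q. (-1) * (inverse (g q) * g' i q * inverse (g q)))" for i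
      using inverse.hyps
      by (intro elementary_on.mult elementary_on.inverse g'(1) elementary_on.const)
  qed
next
  case (ln g)
  then obtain g' where
    g': "\<And>i. elementary_on U (g' i)" "\<And>q. q \<in> U \<Longrightarrow> (g has_derivative (\<lambda>h. \<Sum>i\<in>UNIV. g' i q * h $ i)) (at q)"
    by blast
  show ?case
  proof (intro exI[of _ "\<lambda>i q. inverse (g q) * g' i q"] conjI allI ballI)
    fix q assume q: "q \<in> U"
    have "((\<lambda>q. ln (g q)) has_derivative (\<lambda>k. (\<Sum>i\<in>UNIV. g' i q * k $ i) * inverse (g q))) (at q)"
      using has_derivative_ln[OF ln.hyps(2)[OF q] g'(2)[OF q]] by (simp add: divide_inverse)
    then show "((\<lambda>q. ln (g q)) has_derivative (\<lambda>k. \<Sum>i\<in>UNIV. (inverse (g q) * g' i q) * k $ i)) (at q)"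
      by (simp add: sum_distrib_left sum_distrib_right mult_ac)
  next
    show "elementary_on U (\<lambda>q. inverse (g q) * g' i q)" for i
      using ln.hyps by (intro elementary_on.mult elementary_on.inverse g'(1)) force+
  qed
next
  case (cong g h)
  then obtain g' where
    g': "\<And>i. elementary_on U (g' i)" "\<And>q. q \<in> U \<Longrightarrow> (g has_derivative (\<lambda>h. \<Sum>i\<in>UNIV. g' i q * h $ i)) (at q)"
    by blast
  have "(h has_derivative (\<lambda>k. \<Sum>i\<in>UNIV. g' i q * k $ i)) (at q)" if "q \<in> U" for q
    by (rule has_derivative_transform_within_open[OF g'(2)[OF that] \<open>open U\<close> that])
      (simp add: cong.hyps)
  with g'(1) show ?case by blast
qed

lemma smooth_path_on_subset: "smooth_path_on \<gamma> I \<Longrightarrow> J \<subseteq> I \<Longrightarrow> smooth_path_on \<gamma> J"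
  unfolding smooth_path_on_def by blast

lemma smooth_path_on_continuous: "smooth_path_on \<gamma> I \<Longrightarrow> continuous_on I \<gamma>"
  unfolding smooth_path_on_def
  by (metis continuous_at_imp_continuous_on has_vector_derivative_continuous)

lemma smooth_path_on_linear:
  assumes "bounded_linear T" "smooth_path_on \<gamma> I"
  shows "smooth_path_on (\<lambda>t. T (\<gamma> t)) I"
proof -
  obtain D where D: "D 0 = \<gamma>" "\<And>n t. t \<in> I \<Longrightarrow> (D n has_vector_derivative D (Suc n) t) (at t)"
    using assms(2) unfolding smooth_path_on_def by blast
  show ?thesis
    unfolding smooth_path_on_def using D
    by (intro exI[of _ "\<lambda>n t. T (D n t)"])
      (auto intro: bounded_linear.has_vector_derivative[OF assms(1)])
qed

lemma smooth_path_on_sum: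
  assumes "finite A" "\<And>i. i \<in> A \<Longrightarrow> smooth_path_on (\<gamma> i) I"
  shows "smooth_path_on (\<lambda>t. \<Sum>i\<in>A. \<gamma> i t) I"
proof -
  have "\<forall>i\<in>A. \<exists>D. D 0 = \<gamma> i \<and> (\<forall>n. \<forall>t\<in>I. (D n has_vector_derivative D (Suc n) t) (at t))"
    using assms(2) unfolding smooth_path_on_def by blast
  then obtain D where D: "\<And>i. i \<in> A \<Longrightarrow> D i 0 = \<gamma> i"
    "\<And>i n t. i \<in> A \<Longrightarrow> t \<in> I \<Longrightarrow> (D i n has_vector_derivative D i (Suc n) t) (at t)"
    by metis
  show ?thesis
    unfolding smooth_path_on_def using D
    by (intro exI[of _ "\<lambda>n t. \<Sum>i\<in>A. D i n t"])
      (auto intro!: has_vector_derivative_sum)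
qed

lemma smooth_path_on_vec:
  fixes \<gamma> :: "real \<Rightarrow> real^'n"
  assumes "\<And>i. smooth_path_on (\<lambda>t. \<gamma> t $ i) I"
  shows "smooth_path_on \<gamma> I"
proof -
  have "smooth_path_on (\<lambda>t. \<gamma> t $ i *\<^sub>R axis i 1 :: real^'n) I" for i
    by (rule smooth_path_on_linear[OF bounded_linear_scaleR_left assms])
  then have "smooth_path_on (\<lambda>t. \<Sum>i\<in>UNIV. \<gamma> t $ i *\<^sub>R axis i (1::real)) I"
    using smooth_path_on_sum[of UNIV "\<lambda>i t. \<gamma> t $ i *\<^sub>R axis i (1::real)" I] by simp
  moreover have "(\<lambda>t. \<Sum>i\<in>UNIV. \<gamma> t $ i *\<^sub>R axis i 1) = \<gamma>"
    by (simp add: basis_expansion flip: scalar_mult_eq_scaleR)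
  ultimately show ?thesis by simp
qed

lemma smooth_path_on_Pair:
  fixes c d :: "real \<Rightarrow> real"
  assumes "smooth_path_on c I" "smooth_path_on d I"
  shows "smooth_path_on (\<lambda>t. (c t, d t)) I"
proof -
  obtain D E where D: "D 0 = c" "\<And>n t. t \<in> I \<Longrightarrow> (D n has_vector_derivative D (Suc n) t) (at t)"
    and E: "E 0 = d" "\<And>n t. t \<in> I \<Longrightarrow> (E n has_vector_derivative E (Suc n) t) (at t)"
    using assms unfolding smooth_path_on_def by blast
  show ?thesis
    unfolding smooth_path_on_def using D E
    by (intro exI[of _ "\<lambda>n t. (D n t, E n t)"])
      (auto intro!: has_vector_derivative_Pair)
qed

text \<open>An integral curve of an elementary vector field is \<open>C\<^sup>\<infinity>\<close>: differentiating an elementary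
  function \<open>g\<close> along the curve gives \<open>X g\<close> along the curve, where \<open>X g\<close> is again elementary, so
  the \<open>n\<close>-th derivative of \<open>g \<circ> \<gamma>\<close> is \<open>X\<^sup>n g \<circ> \<gamma>\<close>.\<close>

lemma elementary_on_integral_curve:
  fixes X :: "'n::finite \<Rightarrow> real^'n \<Rightarrow> real"
  assumes U: "open U" and X: "\<And>i. elementary_on U (X i)"
    and \<gamma>: "\<And>t. t \<in> I \<Longrightarrow> \<gamma> t \<in> U" 
      "\<And>t. t \<in> I \<Longrightarrow> (\<gamma> has_vector_derivative (\<chi> i. X i (\<gamma> t))) (at t)"
    and g: "elementary_on U g"
  shows "smooth_path_on (\<lambda>t. g (\<gamma> t)) I"
proof -
  have "\<exists>k. elementary_on U k \<and>
      (\<forall>t\<in>I. ((\<lambda>t. h (\<gamma> t)) has_vector_derivative k (\<gamma> t)) (at t))"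
    if h: "elementary_on U h" for h
  proof -
    obtain h' where h': "\<And>i. elementary_on U (h' i)"
      "\<And>q. q \<in> U \<Longrightarrow> (h has_derivative (\<lambda>v. \<Sum>i\<in>UNIV. h' i q * v $ i)) (at q)"
      using elementary_on_has_derivative[OF h U] by blast
    let ?k = "\<lambda>q. \<Sum>i\<in>UNIV. h' i q * X i q"
    have "elementary_on U ?k"
      by (intro elementary_on_sum elementary_on.mult h' X)
    moreover have "((\<lambda>t. h (\<gamma> t)) has_vector_derivative ?k (\<gamma> t)) (at t)" if "t \<in> I" for t
      using vector_derivative_diff_chain_within[OF \<gamma>(2)[OF that],
          of h "\<lambda>v. \<Sum>i\<in>UNIV. h' i (\<gamma> t) * v $ i"]
        has_derivative_at_withinI[OF h'(2)[OF \<gamma>(1)[OF that]]]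
      by (simp add: o_def)
    ultimately show ?thesis by blast
  qed
  \<comment> \<open>\<open>L\<close> is the Lie derivative along the vector field.\<close>
  then obtain L where L: "\<And>h. elementary_on U h \<Longrightarrow> elementary_on U (L h)"
    "\<And>h t. elementary_on U h \<Longrightarrow> t \<in> I \<Longrightarrow>
        ((\<lambda>t. h (\<gamma> t)) has_vector_derivative L h (\<gamma> t)) (at t)"
    by metis
  have "elementary_on U ((L ^^ n) g)" for n
    by (induction n) (auto intro: g L)
  then show ?thesis
    unfolding smooth_path_on_def
    by (intro exI[of _ "\<lambda>n t. (L ^^ n) g (\<gamma> t)"]) (auto intro: L)
qed

section \<open>Coordinate lines of a local diffeomorphism\<close>

text \<open>The inverse function theorem provides
  \<open>\<gamma> t = \<Phi>\<inverse> (\<Phi> q\<^sub>0 + t e)\<close> with a first derivative only. All higher derivatives come from the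
  differential equation \<open>D\<Phi>(\<gamma>) \<gamma>' = e\<close>: by Cramer's rule, \<open>\<gamma>\<close> is an integral curve of an
  elementary vector field. The last clause says that near \<open>q\<^sub>0\<close> the preimage of the line is
  nothing but the path.\<close>

lemma straightening_path:
  fixes \<Phi> :: "real^'n \<Rightarrow> real^'n" and M :: "real^'n^'n"
  assumes U: "open U" "q\<^sub>0 \<in> U"
    and el: "\<And>i. elementary_on U (\<lambda>q. \<Phi> q $ i)"
    and der: "(\<Phi> has_derivative (\<lambda>h. M *v h)) (at q\<^sub>0)" and M: "det M \<noteq> 0"
    and e: "e \<noteq> 0"
  obtains \<epsilon> \<gamma> where "0 < \<epsilon>" "\<gamma> 0 = q\<^sub>0"
    "\<And>t. t \<in> {-\<epsilon><..<\<epsilon>} \<Longrightarrow> \<gamma> t \<in> U"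
    "\<And>t. t \<in> {-\<epsilon><..<\<epsilon>} \<Longrightarrow> \<Phi> (\<gamma> t) = \<Phi> q\<^sub>0 + t *\<^sub>R e"
    "\<And>g. elementary_on U g \<Longrightarrow> smooth_path_on (\<lambda>t. g (\<gamma> t)) {-\<epsilon><..<\<epsilon>}"
    "\<exists>V. open V \<and> q\<^sub>0 \<in> V \<and>
        (\<forall>q\<in>V. \<forall>t. \<Phi> q = \<Phi> q\<^sub>0 + t *\<^sub>R e \<longrightarrow> \<bar>t\<bar> < \<epsilon> \<and> q = \<gamma> t)"
proof -
  have "\<forall>i. \<exists>d. (\<forall>j. elementary_on U (d j)) \<and>
      (\<forall>q\<in>U. ((\<lambda>q. \<Phi> q $ i) has_derivative (\<lambda>h. \<Sum>j\<in>UNIV. d j q * h $ j)) (at q))"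
    using elementary_on_has_derivative[OF el U(1)] by blast
  from choice[OF this] obtain d where d: "\<And>i j. elementary_on U (d i j)"
    "\<And>i q. q \<in> U \<Longrightarrow> ((\<lambda>q. \<Phi> q $ i) has_derivative (\<lambda>h. \<Sum>j\<in>UNIV. d i j q * h $ j)) (at q)"
    by blast
  define D where "D = (\<lambda>q. (\<chi> i j. d i j q) :: real^'n^'n)"
  have D_el: "elementary_on U (\<lambda>q. D q $ i $ j)" for i j
    by (simp add: D_def d)
  have derD: "(\<Phi> has_derivative (\<lambda>h. D q *v h)) (at q)" if "q \<in> U" for q
  proof -
    have "((\<lambda>x. \<Phi> x \<bullet> i) has_derivative (\<lambda>x. (D q *v x) \<bullet> i)) (at q)" if i: "i \<in> Basis" for i
    proof -
      obtain k where "i = axis k 1"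
        using i by (auto simp: Basis_vec_def)
      then show ?thesis
        using d(2)[OF \<open>q \<in> U\<close>, of k]
        by (simp add: inner_axis matrix_vector_mult_def D_def)
    qed
    then show ?thesis
      by (subst has_derivative_componentwise_within) blast
  qed
  have DM: "D q\<^sub>0 = M"
    using has_derivative_unique[OF derD[OF U(2)] der]
    by (metis matrix_of_matrix_vector_mul)
  have cont_el: "continuous_on U g" if "elementary_on U g" for g
    using elementary_on_has_derivative[OF that U(1)]
    by (meson continuous_at_imp_continuous_on has_derivative_continuous)
  \<comment> \<open>The vector field below has \<open>det (D q)\<close> as denominator, so it is elementary only here.\<close>
  define U1 where "U1 = {q \<in> U. det (D q) \<noteq> 0}"
  have "open (U \<inter> (\<lambda>q. det (D q)) -` (- {0}))"
    by (intro continuous_open_preimage[OF _ U(1)] cont_el elementary_on_det D_el) auto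
  also have "U \<inter> (\<lambda>q. det (D q)) -` (- {0}) = U1"
    by (auto simp: U1_def)
  finally have U1: "open U1" "q\<^sub>0 \<in> U1" "U1 \<subseteq> U"
    using U M DM by (auto simp: U1_def)
  define F where "F = (\<lambda>q. Blinfun (\<lambda>h. D q *v h))"
  have F: "blinfun_apply (F q) = (\<lambda>h. D q *v h)" for q
    unfolding F_def by (rule bounded_linear_Blinfun_apply) (rule matrix_vector_mul_bounded_linear)
  have F_cont: "continuous_on U1 F"
  proof (rule continuous_on_blinfun_componentwise)
    fix b :: "real^'n"
    have *: "continuous_on U1 (\<lambda>q. D q $ i $ j)" for i j
      using cont_el[OF D_el] U1(3) continuous_on_subset by blast
    then show "continuous_on U1 (\<lambda>q. blinfun_apply (F q) b)"
      unfolding F matrix_vector_mult_def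
      by (intro continuous_on_vec_lambda continuous_on_sum continuous_on_mult * continuous_on_const)
  qed
  obtain N where N: "N ** M = mat 1"
    using M invertible_det_nz[of M] unfolding invertible_def by blast
  have inv: "Blinfun (\<lambda>h. N *v h) o\<^sub>L F q\<^sub>0 = id_blinfun"
    by (intro blinfun_eqI)
      (simp add: F DM bounded_linear_Blinfun_apply matrix_vector_mul_bounded_linear
        matrix_vector_mul_assoc N)
  have derF: "(\<Phi> has_derivative blinfun_apply (F q)) (at q)" if "q \<in> U1" for q
    unfolding F using derD that U1(3) by blast
  obtain V W \<Psi> \<Psi>' where VW: "open V" "V \<subseteq> U1" "q\<^sub>0 \<in> V" "open W" "\<Phi> q\<^sub>0 \<in> W"
      "homeomorphism V W \<Phi> \<Psi>"
    and \<Psi>': "\<And>y. y \<in> W \<Longrightarrow> (\<Psi> has_derivative (\<Psi>' y)) (at y)"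
      "\<And>y. y \<in> W \<Longrightarrow> \<Psi>' y = inv (blinfun_apply (F (\<Psi> y)))"
      "\<And>y. y \<in> W \<Longrightarrow> bij (blinfun_apply (F (\<Psi> y)))"
    using inverse_function_theorem[OF U1(1) derF F_cont U1(2) inv] by blast
  obtain r where r: "0 < r" "ball (\<Phi> q\<^sub>0) r \<subseteq> W"
    using VW(4,5) openE by blast
  define \<epsilon> where "\<epsilon> = r / norm e"
  define \<gamma> where "\<gamma> = (\<lambda>t. \<Psi> (\<Phi> q\<^sub>0 + t *\<^sub>R e))"
  have small: "norm (t *\<^sub>R e) < k \<longleftrightarrow> \<bar>t\<bar> < k / norm e" for t k
    using e by (simp add: pos_less_divide_eq)
  have inW: "\<Phi> q\<^sub>0 + t *\<^sub>R e \<in> W" if "t \<in> {-\<epsilon><..<\<epsilon>}" for t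
  proof -
    have "norm (t *\<^sub>R e) < r"
      unfolding small using that by (auto simp: \<epsilon>_def)
    then show ?thesis
      using r(2) by (auto simp: dist_norm)
  qed
  have \<gamma>V: "\<gamma> t \<in> V" "\<Phi> (\<gamma> t) = \<Phi> q\<^sub>0 + t *\<^sub>R e" if "t \<in> {-\<epsilon><..<\<epsilon>}" for t
    using inW[OF that] VW(6) unfolding \<gamma>_def by (auto simp: homeomorphism_def)
  \<comment> \<open>Cramer's solution of \<open>D q *v X = e\<close>.\<close>
  define X where "X = (\<lambda>k q. det (\<chi> i j. if j = k then e $ i else D q $ i $ j) / det (D q))"
  have X: "elementary_on U1 (X k)" for k
  proof -
    have D1: "elementary_on U1 (\<lambda>q. D q $ i $ j)" for i j
      by (rule elementary_on_subset[OF D_el U1(3)])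
    then have "elementary_on U1 (\<lambda>q. (\<chi> i j. if j = k then e $ i else D q $ i $ j) $ i $ j)" for i j
      by (cases "j = k") (simp_all add: elementary_on.const)
    with D1 show ?thesis
      unfolding X_def by (intro elementary_on_divide elementary_on_det) (auto simp: U1_def)
  qed
  have \<gamma>': "(\<gamma> has_vector_derivative (\<chi> k. X k (\<gamma> t))) (at t)" if t: "t \<in> {-\<epsilon><..<\<epsilon>}" for t
  proof -
    let ?y = "\<Phi> q\<^sub>0 + t *\<^sub>R e"
    have "((\<lambda>t. \<Phi> q\<^sub>0 + t *\<^sub>R e) has_vector_derivative e) (at t)"
      by (auto intro!: derivative_eq_intros)
    from vector_derivative_diff_chain_within[OF this has_derivative_at_withinI[OF \<Psi>'(1)[OF inW[OF t]]]]
    have "(\<gamma> has_vector_derivative \<Psi>' ?y e) (at t)"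
      by (simp add: o_def \<gamma>_def)
    moreover have "D (\<gamma> t) *v \<Psi>' ?y e = e"
      using \<Psi>'(2,3)[OF inW[OF t]] unfolding F \<gamma>_def by (metis bij_inv_eq_iff)
    then have "\<Psi>' ?y e = (\<chi> k. X k (\<gamma> t))"
      unfolding X_def using cramer[of "D (\<gamma> t)"] \<gamma>V(1)[OF t] VW(2) by (auto simp: U1_def)
    ultimately show ?thesis by simp
  qed
  show ?thesis
  proof (rule that)
    show "0 < \<epsilon>" using r e by (simp add: \<epsilon>_def)
    then show "\<gamma> 0 = q\<^sub>0"
      using VW(3,6) by (simp add: \<gamma>_def homeomorphism_def)
    show "\<gamma> t \<in> U" if "t \<in> {-\<epsilon><..<\<epsilon>}" for t
      using \<gamma>V(1)[OF that] VW(2) U1(3) by blast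
    show "\<Phi> (\<gamma> t) = \<Phi> q\<^sub>0 + t *\<^sub>R e" if "t \<in> {-\<epsilon><..<\<epsilon>}" for t
      by (rule \<gamma>V(2)[OF that])
    show "smooth_path_on (\<lambda>t. g (\<gamma> t)) {-\<epsilon><..<\<epsilon>}" if "elementary_on U g" for g
      by (rule elementary_on_integral_curve[OF U1(1) X _ \<gamma>' elementary_on_subset[OF that U1(3)]])
        (use \<gamma>V(1) VW(2) in auto)
    show "\<exists>V. open V \<and> q\<^sub>0 \<in> V \<and>
        (\<forall>q\<in>V. \<forall>t. \<Phi> q = \<Phi> q\<^sub>0 + t *\<^sub>R e \<longrightarrow> \<bar>t\<bar> < \<epsilon> \<and> q = \<gamma> t)"
    proof (intro exI[of _ "V \<inter> \<Phi> -` ball (\<Phi> q\<^sub>0) (r)"] conjI ballI allI impI)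
      show "open (V \<inter> \<Phi> -` ball (\<Phi> q\<^sub>0) (r))"
        using continuous_open_preimage[OF homeomorphism_cont1[OF VW(6)] VW(1)] by blast
      show "q\<^sub>0 \<in> V \<inter> \<Phi> -` ball (\<Phi> q\<^sub>0) (r)"
        using VW(3) r(1) by simp
      fix q t assume q: "q \<in> V \<inter> \<Phi> -` ball (\<Phi> q\<^sub>0) (r)" "\<Phi> q = \<Phi> q\<^sub>0 + t *\<^sub>R e"
      then have "norm (t *\<^sub>R e) < r"
        by (simp add: dist_norm)
      then show "\<bar>t\<bar> < \<epsilon>"
        unfolding small \<epsilon>_def by simp
      show "q = \<gamma> t"
        using VW(6) q unfolding \<gamma>_def homeomorphism_def by (metis IntD1)
    qed
  qed
qed

section \<open>Real coordinates on the torus and calculus of Laurent polynomials\<close>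

lemma elementary_on_vec_has_derivative:
  fixes \<Phi> :: "real^'n \<Rightarrow> real^'m"
  assumes "open U" "q \<in> U" "\<And>i. elementary_on U (\<lambda>q. \<Phi> q $ i)"
  shows "(\<Phi> has_derivative (\<lambda>h. jacobian \<Phi> (at q) *v h)) (at q)"
proof -
  have "((\<lambda>x. \<Phi> x \<bullet> b)) differentiable (at q)" if b: "b \<in> Basis" for b
  proof -
    obtain k where "b = axis k 1"
      using b by (auto simp: Basis_vec_def)
    then show ?thesis
      using elementary_on_has_derivative[OF assms(3)[of k] assms(1)] assms(2)
      by (auto simp: inner_axis differentiable_def)
  qed
  then have "\<Phi> differentiable (at q)"
    by (subst differentiable_componentwise_within) blast
  then show ?thesis by (simp add: jacobian_works)
qed

text \<open>Complex-valued functions enter through their real and imaginary parts, so that products and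
  inverses of Laurent monomials can be treated as such.\<close>

definition complex_elementary_on :: "(real^'n) set \<Rightarrow> (real^'n \<Rightarrow> complex) \<Rightarrow> bool" where
  "complex_elementary_on U F \<longleftrightarrow> elementary_on U (\<lambda>q. Re (F q)) \<and> elementary_on U (\<lambda>q. Im (F q))"

lemma complex_elementary_on_const: "complex_elementary_on U (\<lambda>q. c)"
  by (simp add: complex_elementary_on_def elementary_on.const)

lemma complex_elementary_on_add:
  "complex_elementary_on U F \<Longrightarrow> complex_elementary_on U H \<Longrightarrow> complex_elementary_on U (\<lambda>q. F q + H q)"
  by (simp add: complex_elementary_on_def elementary_on.add)

lemma complex_elementary_on_mult:
  "complex_elementary_on U F \<Longrightarrow> complex_elementary_on U H \<Longrightarrow> complex_elementary_on U (\<lambda>q. F q * H q)"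
  by (simp add: complex_elementary_on_def elementary_on.add elementary_on_diff elementary_on.mult)

lemma complex_elementary_on_cnj:
  "complex_elementary_on U F \<Longrightarrow> complex_elementary_on U (\<lambda>q. cnj (F q))"
  by (simp add: complex_elementary_on_def elementary_on_uminus)

lemma complex_elementary_on_inverse:
  assumes "complex_elementary_on U F" "\<And>q. q \<in> U \<Longrightarrow> F q \<noteq> 0"
  shows "complex_elementary_on U (\<lambda>q. inverse (F q))"
proof -
  have "(Re (F q))\<^sup>2 + (Im (F q))\<^sup>2 \<noteq> 0" if "q \<in> U" for q
    using assms(2)[OF that] by (simp add: complex_eq_iff sum_power2_eq_zero_iff)
  with assms(1) show ?thesis
    unfolding complex_elementary_on_def inverse_complex.simps power2_eq_square
    by (auto intro!: elementary_on_divide elementary_on.add elementary_on.mult elementary_on_uminus)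
qed

lemma complex_elementary_on_sum:
  "(\<And>i. i \<in> I \<Longrightarrow> complex_elementary_on U (F i)) \<Longrightarrow> complex_elementary_on U (\<lambda>q. \<Sum>i\<in>I. F i q)"
  by (induction I rule: infinite_finite_induct)
    (auto intro: complex_elementary_on_const complex_elementary_on_add)

lemma complex_elementary_on_cong:
  "complex_elementary_on U F \<Longrightarrow> (\<And>q. q \<in> U \<Longrightarrow> H q = F q) \<Longrightarrow> complex_elementary_on U H"
  unfolding complex_elementary_on_def by (metis elementary_on.cong)

lemma complex_elementary_on_power:
  "complex_elementary_on U F \<Longrightarrow> complex_elementary_on U (\<lambda>q. F q ^ n)"
  by (induction n) (auto intro: complex_elementary_on_const complex_elementary_on_mult)

lemma complex_elementary_on_power_int:
  assumes "complex_elementary_on U F" "\<And>q. q \<in> U \<Longrightarrow> F q \<noteq> 0"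
  shows "complex_elementary_on U (\<lambda>q. F q powi n)"
proof (cases "n \<ge> 0")
  case True
  then show ?thesis
    using complex_elementary_on_power[OF assms(1), of "nat n"] by (simp add: power_int_def)
next
  case False
  then show ?thesis
    using complex_elementary_on_power[OF complex_elementary_on_inverse[OF assms], of "nat (- n)"]
    by (simp add: power_int_def)
qed

definition complex_coords :: "real^4 \<Rightarrow> complex \<times> complex" where
  "complex_coords q = (zc q, wc q)"

definition real_coords :: "complex \<times> complex \<Rightarrow> real^4" where
  "real_coords p = vector [Re (fst p), Im (fst p), Re (snd p), Im (snd p)]"

lemma vector_4 [simp]:
  "(vector [a, b, c, d] :: 'a::zero^4) $ 1 = a"
  "(vector [a, b, c, d] :: 'a::zero^4) $ 2 = b"
  "(vector [a, b, c, d] :: 'a::zero^4) $ 3 = c"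
  "(vector [a, b, c, d] :: 'a::zero^4) $ 4 = d"
  unfolding vector_def by auto

lemma complex_real_coords [simp]: "complex_coords (real_coords p) = p"
  by (simp add: complex_coords_def real_coords_def zc_def wc_def)

lemma real_complex_coords [simp]: "real_coords (complex_coords q) = q"
  by (simp add: complex_coords_def real_coords_def zc_def wc_def vec_eq_iff forall_4)

lemma complex_coords_eq_iff [simp]: "complex_coords q = complex_coords q' \<longleftrightarrow> q = q'"
  by (metis real_complex_coords)

lemma bounded_linear_zc: "bounded_linear zc"
  unfolding linear_conv_bounded_linear[symmetric]
  by (rule linearI) (simp_all add: zc_def complex_eq_iff)

lemma bounded_linear_wc: "bounded_linear wc"
  unfolding linear_conv_bounded_linear[symmetric]
  by (rule linearI) (simp_all add: wc_def complex_eq_iff)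

lemma bounded_linear_complex_coords: "bounded_linear complex_coords"
  unfolding complex_coords_def
  by (intro bounded_linear_Pair bounded_linear_zc bounded_linear_wc)

lemma bounded_linear_real_coords: "bounded_linear real_coords"
  unfolding linear_conv_bounded_linear[symmetric]
  by (rule linearI) (simp_all add: real_coords_def vec_eq_iff forall_4)

definition torus_coords :: "(real^4) set" where
  "torus_coords = {q. zc q \<noteq> 0 \<and> wc q \<noteq> 0}"

lemma open_torus_coords: "open torus_coords"
  unfolding torus_coords_def
  by (intro open_Collect_conj open_Collect_neq continuous_on_const
      linear_continuous_on bounded_linear_zc bounded_linear_wc)

lemma zc_elementary: "complex_elementary_on U zc"
  by (simp add: complex_elementary_on_def zc_def elementary_on.coord)

lemma wc_elementary: "complex_elementary_on U wc"
  by (simp add: complex_elementary_on_def wc_def elementary_on.coord)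

lemma ldz_eq:
  assumes "z \<noteq> 0"
  shows "ldz f z w = (\<Sum>k\<in>Poly_Mapping.keys f. Poly_Mapping.lookup f k *
           (of_int (fst k) * z powi (fst k - 1)) * w powi snd k)"
  unfolding ldz_def leval_def
  by (intro DERIV_imp_deriv) (use assms in \<open>auto intro!: derivative_eq_intros sum.cong\<close>)

lemma ldw_eq:
  assumes "w \<noteq> 0"
  shows "ldw f z w = (\<Sum>k\<in>Poly_Mapping.keys f. Poly_Mapping.lookup f k *
           z powi fst k * (of_int (snd k) * w powi (snd k - 1)))"
  unfolding ldw_def leval_def
  by (intro DERIV_imp_deriv) (use assms in \<open>auto intro!: derivative_eq_intros sum.cong\<close>)

lemma leval_has_derivative:
  assumes "z \<noteq> 0" "w \<noteq> 0"
  shows "((\<lambda>p. leval f (fst p) (snd p)) has_derivative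
           (\<lambda>v. ldz f z w * fst v + ldw f z w * snd v)) (at (z, w))"
proof -
  have "((\<lambda>p. leval f (fst p) (snd p)) has_derivative
      (\<lambda>v. \<Sum>k\<in>Poly_Mapping.keys f. Poly_Mapping.lookup f k *
           (z powi fst k * (snd v * (of_int (snd k) * w powi (snd k - 1))) +
            (fst v * (of_int (fst k) * z powi (fst k - 1))) * w powi snd k))) (at (z, w))"
    unfolding leval_def mult.assoc
    using assms by (auto intro!: derivative_eq_intros simp: algebra_simps)
  moreover have "(\<lambda>v. \<Sum>k\<in>Poly_Mapping.keys f. Poly_Mapping.lookup f k *
           (z powi fst k * (snd v * (of_int (snd k) * w powi (snd k - 1))) +
            (fst v * (of_int (fst k) * z powi (fst k - 1))) * w powi snd k)) =
      (\<lambda>v. ldz f z w * fst v + ldw f z w * snd v)"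
    unfolding ldz_eq[OF assms(1)] ldw_eq[OF assms(2)] sum_distrib_right sum.distrib[symmetric]
    by (auto simp: algebra_simps intro!: sum.cong)
  ultimately show ?thesis by simp
qed

lemma leval_elementary: "complex_elementary_on torus_coords (\<lambda>q. leval f (zc q) (wc q))"
  unfolding leval_def
  by (intro complex_elementary_on_sum complex_elementary_on_mult complex_elementary_on_const
      complex_elementary_on_power_int zc_elementary wc_elementary) (auto simp: torus_coords_def)

lemma Afun_elementary: "complex_elementary_on torus_coords (Afun f)"
proof (rule complex_elementary_on_cong)
  show "complex_elementary_on torus_coords (\<lambda>q. zc q * (\<Sum>k\<in>Poly_Mapping.keys f.
      Poly_Mapping.lookup f k * (of_int (fst k) * zc q powi (fst k - 1)) * wc q powi snd k))"
    by (intro complex_elementary_on_sum complex_elementary_on_mult complex_elementary_on_const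
      complex_elementary_on_power_int zc_elementary wc_elementary) (auto simp: torus_coords_def)
qed (auto simp: Afun_def torus_coords_def ldz_eq)

lemma Bfun_elementary: "complex_elementary_on torus_coords (Bfun f)"
proof (rule complex_elementary_on_cong)
  show "complex_elementary_on torus_coords (\<lambda>q. wc q * (\<Sum>k\<in>Poly_Mapping.keys f.
      Poly_Mapping.lookup f k * zc q powi fst k * (of_int (snd k) * wc q powi (snd k - 1))))"
    by (intro complex_elementary_on_sum complex_elementary_on_mult complex_elementary_on_const
      complex_elementary_on_power_int zc_elementary wc_elementary) (auto simp: torus_coords_def)
qed (auto simp: Bfun_def torus_coords_def ldw_eq)

lemma ufun_elementary: "elementary_on torus_coords (ufun f)"
  and vfun_elementary: "elementary_on torus_coords (vfun f)"
  using leval_elementary[of f] unfolding complex_elementary_on_def ufun_def[abs_def] vfun_def[abs_def]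
  by auto

lemma rho_elementary: "elementary_on torus_coords (rho f)"
  using complex_elementary_on_mult[OF Afun_elementary[of f]
      complex_elementary_on_cnj[OF Bfun_elementary[of f]]]
  unfolding complex_elementary_on_def rho_def[abs_def] by auto

lemma Rsq_eq: "Rsq q = (cmod (zc q))\<^sup>2" and Ssq_eq: "Ssq q = (cmod (wc q))\<^sup>2"
  by (simp_all add: Rsq_def Ssq_def zc_def wc_def cmod_power2)

lemma ln_cmod_elementary:
  "elementary_on torus_coords (\<lambda>q. ln (cmod (zc q)))"
  "elementary_on torus_coords (\<lambda>q. ln (cmod (wc q)))"
proof -
  have pos: "0 < Rsq q" "0 < Ssq q" if "q \<in> torus_coords" for q
    using that by (auto simp: Rsq_eq Ssq_eq torus_coords_def)
  have "elementary_on torus_coords (\<lambda>q. 1/2 * ln (Rsq q))" "elementary_on torus_coords (\<lambda>q. 1/2 * ln (Ssq q))"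
    unfolding Rsq_def Ssq_def power2_eq_square
    by (intro elementary_on.mult elementary_on.const elementary_on.ln elementary_on.add elementary_on.coord;
        use pos in \<open>simp add: Rsq_def Ssq_def power2_eq_square\<close>)+
  then show "elementary_on torus_coords (\<lambda>q. ln (cmod (zc q)))"
    "elementary_on torus_coords (\<lambda>q. ln (cmod (wc q)))"
    by (simp_all add: Rsq_eq Ssq_eq ln_realpow elementary_on.cong torus_coords_def)
qed

lemma ln_cmod_has_derivative:
  assumes "z \<noteq> 0"
  shows "((\<lambda>z. ln (cmod z)) has_derivative (\<lambda>h. Re (h / z))) (at z)"
proof -
  have *: "inverse (cmod z) * inner (sgn z) h = Re (h / z)" for h
  proof -
    have "inverse (cmod z) * inner (sgn z) h = inner z h / (cmod z)\<^sup>2"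
      by (simp add: sgn_div_norm power2_eq_square divide_inverse)
    then show ?thesis
      by (simp add: inner_complex_def Re_divide cmod_power2 mult.commute)
  qed
  show ?thesis
    by (rule derivative_eq_intros has_derivative_norm refl | use assms in simp)+
      (use assms in \<open>simp add: *[symmetric] fun_eq_iff field_simps inner_commute\<close>)
qed

lemma Log_has_derivative:
  assumes "z \<noteq> 0" "w \<noteq> 0"
  shows "(Log has_derivative (\<lambda>v. (Re (fst v / z), Re (snd v / w)))) (at (z, w))"
proof -
  have 1: "((\<lambda>p. ln (cmod (fst p))) has_derivative (\<lambda>v. Re (fst v / z))) (at (z, w))"
    using has_derivative_compose[OF has_derivative_fst[OF has_derivative_ident]
        ln_cmod_has_derivative, of "(z, w)" UNIV] assms by simp
  have 2: "((\<lambda>p. ln (cmod (snd p))) has_derivative (\<lambda>v. Re (snd v / w))) (at (z, w))"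
    using has_derivative_compose[OF has_derivative_snd[OF has_derivative_ident]
        ln_cmod_has_derivative, of "(z, w)" UNIV] assms by simp
  show ?thesis
    using has_derivative_Pair[OF 1 2] by (simp add: Log_def case_prod_beta')
qed

lemma dLog_eq:
  assumes "z \<noteq> 0" "w \<noteq> 0"
  shows "dLog (z, w) v = (Re (fst v / z), Re (snd v / w))"
  using frechet_derivative_at[OF Log_has_derivative[OF assms], symmetric] by simp

section \<open>The critical locus in real coordinates\<close>

lemma smooth_path_on_has_derivative:
  assumes "smooth_path_on \<gamma> I" "t \<in> I"
  obtains v where "(\<gamma> has_vector_derivative v) (at t)"
  using assms unfolding smooth_path_on_def by metis

lemma Log_path_has_derivative:
  assumes "(\<gamma> has_vector_derivative v) (at t)" "fst (\<gamma> t) \<noteq> 0" "snd (\<gamma> t) \<noteq> 0"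
  shows "((\<lambda>t. Log (\<gamma> t)) has_vector_derivative dLog (\<gamma> t) v) (at t)"
proof -
  have "(Log has_derivative dLog (\<gamma> t)) (at (\<gamma> t))"
    using Log_has_derivative[OF assms(2,3)] dLog_eq[OF assms(2,3)]
    by (metis (no_types, lifting) frechet_derivative_at prod.collapse)
  from vector_derivative_diff_chain_within[OF assms(1) has_derivative_at_withinI[OF this]]
  show ?thesis by (simp add: o_def)
qed

lemma complex_coords_path_smooth:
  assumes "\<And>g. elementary_on U g \<Longrightarrow> smooth_path_on (\<lambda>t. g (\<gamma> t)) I"
  shows "smooth_path_on (\<lambda>t. complex_coords (\<gamma> t)) I"
  by (intro smooth_path_on_linear[OF bounded_linear_complex_coords] smooth_path_on_vec assms
      elementary_on.coord)

lemma tangent_curve_kernel: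
  assumes "(z, w) \<in> curve f" "v \<in> tangent_vectors (curve f) (z, w)"
  shows "ldz f z w * fst v + ldw f z w * snd v = 0"
proof -
  obtain \<gamma> \<epsilon> where \<gamma>: "0 < \<epsilon>" "\<gamma> ` {-\<epsilon><..<\<epsilon>} \<subseteq> curve f" "\<gamma> 0 = (z, w)"
    "(\<gamma> has_vector_derivative v) (at 0)"
    using assms(2) unfolding tangent_vectors_def by blast
  let ?F = "\<lambda>p. leval f (fst p) (snd p)"
  have "(?F has_derivative (\<lambda>v. ldz f z w * fst v + ldw f z w * snd v)) (at (\<gamma> 0))"
    using assms(1) \<gamma>(3) by (auto simp: curve_def intro: leval_has_derivative)
  from vector_derivative_diff_chain_within[OF \<gamma>(4) has_derivative_at_withinI[OF this]]
  have "((\<lambda>t. ?F (\<gamma> t)) has_vector_derivative (ldz f z w * fst v + ldw f z w * snd v)) (at 0)"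
    by (simp add: o_def)
  moreover have "((\<lambda>t. ?F (\<gamma> t)) has_vector_derivative 0) (at 0)"
  proof (rule has_vector_derivative_transform_within_open)
    show "((\<lambda>t. 0::complex) has_vector_derivative 0) (at (0::real))" by simp
    show "open {-\<epsilon><..<\<epsilon>}" "0 \<in> {-\<epsilon><..<\<epsilon>}" using \<gamma>(1) by auto
    show "0 = ?F (\<gamma> t)" if "t \<in> {-\<epsilon><..<\<epsilon>}" for t
    proof -
      have "\<gamma> t \<in> curve f" using \<gamma>(2) that by blast
      then show ?thesis by (auto simp: curve_def)
    qed
  qed
  ultimately show ?thesis
    using vector_derivative_unique_at by blast
qed

lemma Log_complex_coords: "Log (complex_coords q) = (ln (cmod (zc q)), ln (cmod (wc q)))"
  by (simp add: Log_def complex_coords_def)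

lemma curve_complex_coords:
  "complex_coords q \<in> curve f \<longleftrightarrow> q \<in> torus_coords \<and> ufun f q = 0 \<and> vfun f q = 0"
  by (auto simp: curve_def complex_coords_def torus_coords_def ufun_def vfun_def complex_eq_iff)

lemma uv_has_derivative:
  assumes "q \<in> torus_coords"
  shows "(ufun f has_derivative (\<lambda>h. Re (ldz f (zc q) (wc q) * zc h + ldw f (zc q) (wc q) * wc h))) (at q)"
    "(vfun f has_derivative (\<lambda>h. Im (ldz f (zc q) (wc q) * zc h + ldw f (zc q) (wc q) * wc h))) (at q)"
proof -
  have "((\<lambda>q. leval f (fst (complex_coords q)) (snd (complex_coords q))) has_derivative
      (\<lambda>h. ldz f (zc q) (wc q) * fst (complex_coords h) + ldw f (zc q) (wc q) * snd (complex_coords h))) (at q)"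
    by (rule has_derivative_compose[OF bounded_linear_imp_has_derivative[OF bounded_linear_complex_coords]])
      (use assms in \<open>auto simp: complex_coords_def torus_coords_def intro!: leval_has_derivative\<close>)
  then have *: "((\<lambda>q. leval f (zc q) (wc q)) has_derivative
      (\<lambda>h. ldz f (zc q) (wc q) * zc h + ldw f (zc q) (wc q) * wc h)) (at q)"
    by (simp add: complex_coords_def)
  show "(ufun f has_derivative (\<lambda>h. Re (ldz f (zc q) (wc q) * zc h + ldw f (zc q) (wc q) * wc h))) (at q)"
    "(vfun f has_derivative (\<lambda>h. Im (ldz f (zc q) (wc q) * zc h + ldw f (zc q) (wc q) * wc h))) (at q)"
    unfolding ufun_def[abs_def] vfun_def[abs_def]
    by (intro bounded_linear.has_derivative[OF bounded_linear_Re *]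
        bounded_linear.has_derivative[OF bounded_linear_Im *])+
qed

lemma ln_cmod_coords_has_derivative:
  assumes "q \<in> torus_coords"
  shows "((\<lambda>q. ln (cmod (zc q))) has_derivative (\<lambda>h. Re (zc h / zc q))) (at q)"
    "((\<lambda>q. ln (cmod (wc q))) has_derivative (\<lambda>h. Re (wc h / wc q))) (at q)"
  using assms
  by (auto simp: torus_coords_def intro!: ln_cmod_has_derivative
      has_derivative_compose[OF bounded_linear_imp_has_derivative[OF bounded_linear_zc]]
      has_derivative_compose[OF bounded_linear_imp_has_derivative[OF bounded_linear_wc]])

text \<open>Where \<open>\<rho> \<noteq> 0\<close>, no nonzero tangent vector of the curve is killed by \<open>dLog\<close>. A killed vector has
  purely imaginary logarithmic components \<open>h / z = i \<theta>\<close> and \<open>k / w = i \<eta>\<close>, and tangency becomes the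
  real relation \<open>\<theta> A + \<eta> B = 0\<close>; but \<open>\<rho> \<noteq> 0\<close> says that \<open>A\<close> and \<open>B\<close> are linearly independent over
  the reals.\<close>

lemma rho_kernel_trivial:
  fixes z w a b h k :: complex
  assumes "z \<noteq> 0" "w \<noteq> 0" "Im (z * a * cnj (w * b)) \<noteq> 0"
    and "a * h + b * k = 0" "Re (h / z) = 0" "Re (k / w) = 0"
  shows "h = 0 \<and> k = 0"
proof -
  define \<theta> \<eta> where "\<theta> = Im (h / z)" and "\<eta> = Im (k / w)"
  have "h / z = \<i> * \<theta>" "k / w = \<i> * \<eta>"
    using assms(5,6) by (simp_all add: \<theta>_def \<eta>_def complex_eq_iff)
  then have h: "h = z * (\<i> * \<theta>)" "k = w * (\<i> * \<eta>)"
    using assms(1,2) by (metis nonzero_mult_div_cancel_left times_divide_eq_right)+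
  then have "\<i> * (z * a * \<theta> + w * b * \<eta>) = 0"
    using assms(4) by (simp add: algebra_simps)
  then have *: "z * a * \<theta> + w * b * \<eta> = 0"
    by simp
  have "(z * a * \<theta> + w * b * \<eta>) * cnj (w * b) = 0" "(z * a * \<theta> + w * b * \<eta>) * cnj (z * a) = 0"
    using * by simp_all
  then have "Im (z * a * cnj (w * b)) * \<theta> = 0" "Im (z * a * cnj (w * b)) * \<eta> = 0"
    by (simp_all add: complex_eq_iff algebra_simps)
  then show ?thesis
    using h assms(3) by simp
qed

text \<open>If \<open>\<rho> \<noteq> 0\<close>, then \<open>(u, v, log |z|, log |w|)\<close> is a local coordinate system. Lines
  on which \<open>u = v = 0\<close> in these coordinates are paths in the curve, and along them \<open>Log\<close> moves with
  any prescribed nonzero velocity.\<close>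

lemma noncritical_tangent_image:
  assumes q: "complex_coords q \<in> curve f" and rho: "rho f q \<noteq> 0" and ab: "(a, b) \<noteq> (0, 0)"
  shows "(a, b) \<in> dLog (complex_coords q) ` tangent_vectors (curve f) (complex_coords q)"
proof -
  define \<Phi> :: "real^4 \<Rightarrow> real^4" where
    "\<Phi> = (\<lambda>q. vector [ufun f q, vfun f q, ln (cmod (zc q)), ln (cmod (wc q))])"
  have el: "elementary_on torus_coords (\<lambda>q. \<Phi> q $ i)" for i
    using exhaust_4[of i]
    by (auto simp: \<Phi>_def ufun_elementary vfun_elementary ln_cmod_elementary)
  have q_torus: "q \<in> torus_coords" and uv: "ufun f q = 0" "vfun f q = 0"
    using q by (auto simp: curve_complex_coords)
  then have zw: "zc q \<noteq> 0" "wc q \<noteq> 0" by (auto simp: torus_coords_def)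
  let ?M = "jacobian \<Phi> (at q)"
  have der: "(\<Phi> has_derivative (\<lambda>h. ?M *v h)) (at q)"
    by (rule elementary_on_vec_has_derivative[OF open_torus_coords q_torus el])
  have comp: "((\<lambda>q. \<Phi> q $ i) has_derivative (\<lambda>h. (?M *v h) $ i)) (at q)" for i
    by (rule bounded_linear.has_derivative[OF bounded_linear_vec_nth der])
  have "h = 0" if h: "?M *v h = 0" for h
  proof -
    have "(\<lambda>h. (?M *v h) $ 1) = (\<lambda>h. Re (ldz f (zc q) (wc q) * zc h + ldw f (zc q) (wc q) * wc h))"
      by (rule has_derivative_unique[OF comp]) (use uv_has_derivative[OF q_torus] in \<open>simp add: \<Phi>_def\<close>)
    moreover have "(\<lambda>h. (?M *v h) $ 2) = (\<lambda>h. Im (ldz f (zc q) (wc q) * zc h + ldw f (zc q) (wc q) * wc h))"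
      by (rule has_derivative_unique[OF comp]) (use uv_has_derivative[OF q_torus] in \<open>simp add: \<Phi>_def\<close>)
    moreover have "(\<lambda>h. (?M *v h) $ 3) = (\<lambda>h. Re (zc h / zc q))"
      by (rule has_derivative_unique[OF comp]) (use ln_cmod_coords_has_derivative[OF q_torus] in \<open>simp add: \<Phi>_def\<close>)
    moreover have "(\<lambda>h. (?M *v h) $ 4) = (\<lambda>h. Re (wc h / wc q))"
      by (rule has_derivative_unique[OF comp]) (use ln_cmod_coords_has_derivative[OF q_torus] in \<open>simp add: \<Phi>_def\<close>)
    ultimately have "Re (ldz f (zc q) (wc q) * zc h + ldw f (zc q) (wc q) * wc h) = (?M *v h) $ 1"
      "Im (ldz f (zc q) (wc q) * zc h + ldw f (zc q) (wc q) * wc h) = (?M *v h) $ 2"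
      "Re (zc h / zc q) = (?M *v h) $ 3" "Re (wc h / wc q) = (?M *v h) $ 4"
      by (simp_all only: fun_eq_iff)
    then have "ldz f (zc q) (wc q) * zc h + ldw f (zc q) (wc q) * wc h = 0"
      "Re (zc h / zc q) = 0" "Re (wc h / wc q) = 0"
      unfolding h by (auto simp: complex_eq_iff)
    then have "zc h = 0 \<and> wc h = 0"
      using rho_kernel_trivial[OF zw] rho unfolding rho_def Afun_def Bfun_def by blast
    then show "h = 0"
      by (simp add: zc_def wc_def complex_eq_iff vec_eq_iff forall_4)
  qed
  then have det: "det ?M \<noteq> 0"
    by (metis invertible_det_nz invertible_left_inverse matrix_left_invertible_ker)
  \<comment> \<open>Keeping \<open>u\<close> and \<open>v\<close> constant keeps the path on the curve.\<close>
  define e :: "real^4" where "e = vector [0, 0, a, b]"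
  have "e \<noteq> 0"
    using ab by (auto simp: e_def vec_eq_iff forall_4)
  obtain \<epsilon> \<gamma> where \<gamma>: "0 < \<epsilon>" "\<gamma> 0 = q"
    "\<And>t. t \<in> {-\<epsilon><..<\<epsilon>} \<Longrightarrow> \<gamma> t \<in> torus_coords"
    "\<And>t. t \<in> {-\<epsilon><..<\<epsilon>} \<Longrightarrow> \<Phi> (\<gamma> t) = \<Phi> q + t *\<^sub>R e"
    "\<And>g. elementary_on torus_coords g \<Longrightarrow> smooth_path_on (\<lambda>t. g (\<gamma> t)) {-\<epsilon><..<\<epsilon>}"
    by (rule straightening_path[OF open_torus_coords q_torus el der det \<open>e \<noteq> 0\<close>]) blast
  let ?c = "\<lambda>t. complex_coords (\<gamma> t)"
  have sm: "smooth_path_on ?c {-\<epsilon><..<\<epsilon>}"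
    by (rule complex_coords_path_smooth[OF \<gamma>(5)])
  then obtain v where v: "(?c has_vector_derivative v) (at 0)"
    using smooth_path_on_has_derivative[of ?c "{-\<epsilon><..<\<epsilon>}" 0] \<gamma>(1) by auto
  have val: "ufun f (\<gamma> t) = 0" "vfun f (\<gamma> t) = 0"
    "Log (?c t) = Log (complex_coords q) + t *\<^sub>R (a, b)" if "t \<in> {-\<epsilon><..<\<epsilon>}" for t
    using \<gamma>(4)[OF that] uv
    by (simp_all add: \<Phi>_def e_def vec_eq_iff forall_4 Log_complex_coords)
  have "?c ` {-\<epsilon><..<\<epsilon>} \<subseteq> curve f"
    using val(1,2) \<gamma>(3) by (auto simp: curve_complex_coords)
  then have "v \<in> tangent_vectors (curve f) (complex_coords q)"
    unfolding tangent_vectors_def using \<gamma>(1,2) sm v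
    by (intro CollectI exI[of _ ?c] exI[of _ \<epsilon>]) auto
  moreover have "((\<lambda>t. Log (?c t)) has_vector_derivative dLog (?c 0) v) (at 0)"
    by (rule Log_path_has_derivative[OF v]) (use zw \<gamma>(2) in \<open>auto simp: complex_coords_def\<close>)
  moreover have "((\<lambda>t. Log (?c t)) has_vector_derivative (a, b)) (at 0)"
  proof (rule has_vector_derivative_transform_within_open)
    show "((\<lambda>t. Log (complex_coords q) + t *\<^sub>R (a, b)) has_vector_derivative (a, b)) (at 0)"
      by (auto intro!: derivative_eq_intros)
    show "open {-\<epsilon><..<\<epsilon>}" "0 \<in> {-\<epsilon><..<\<epsilon>}" using \<gamma>(1) by auto
  qed (use val(3) in simp)
  ultimately show ?thesis
    using vector_derivative_unique_at \<gamma>(2) by blast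
qed

text \<open>Multiplying \<open>A a + B b = 0\<close> by the conjugate of \<open>A\<close> or of \<open>B\<close> makes both coefficients real, so
  the real parts of \<open>a\<close> and \<open>b\<close> satisfy the same relation. Both forms are wanted because either
  of \<open>A\<close> and \<open>B\<close> may vanish, and then one of the two relations is trivial.\<close>

lemma real_ratio_kernel:
  fixes a b A B :: complex
  assumes "A * a + B * b = 0" "Im (A * cnj B) = 0"
  shows "(cmod A)\<^sup>2 * Re a + Re (cnj A * B) * Re b = 0"
    "Re (A * cnj B) * Re a + (cmod B)\<^sup>2 * Re b = 0"
proof -
  have "Re ((A * a + B * b) * cnj A) = (cmod A)\<^sup>2 * Re a + Re (cnj A * B) * Re b + Im (A * cnj B) * Im b"
    "Re ((A * a + B * b) * cnj B) = Re (A * cnj B) * Re a + (cmod B)\<^sup>2 * Re b - Im (A * cnj B) * Im a"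
    unfolding cmod_power2 unfolding power2_eq_square by (simp_all add: algebra_simps)
  with assms show "(cmod A)\<^sup>2 * Re a + Re (cnj A * B) * Re b = 0"
    "Re (A * cnj B) * Re a + (cmod B)\<^sup>2 * Re b = 0"
    by (simp_all del: times_complex.sel)
qed

text \<open>For \<open>\<rho> = 0\<close> the numbers \<open>A\<close> and \<open>B\<close> are linearly dependent over the reals, so the real parts of the logarithmic components
  of a tangent vector satisfy one fixed nontrivial real linear relation.\<close>

lemma critical_tangent_image_dim:
  assumes "crit_eqs f q"
  shows "dim (dLog (complex_coords q) ` tangent_vectors (curve f) (complex_coords q)) < 2"
proof -
  let ?z = "zc q" and ?w = "wc q" and ?A = "Afun f q" and ?B = "Bfun f q"
  have zw: "?z \<noteq> 0" "?w \<noteq> 0" and AB: "?A \<noteq> 0 \<or> ?B \<noteq> 0" and rho: "Im (?A * cnj ?B) = 0"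
    and q: "(?z, ?w) \<in> curve f"
    using assms by (auto simp: crit_eqs_def rho_def curve_def ufun_def vfun_def complex_eq_iff)
  have ker: "?A * (fst v / ?z) + ?B * (snd v / ?w) = 0"
    if "v \<in> tangent_vectors (curve f) (?z, ?w)" for v
    using tangent_curve_kernel[OF q that] zw by (simp add: Afun_def Bfun_def)
  define n where "n = (if ?A \<noteq> 0 then ((cmod ?A)\<^sup>2, Re (cnj ?A * ?B)) else (Re (?A * cnj ?B), (cmod ?B)\<^sup>2))"
  have "n \<noteq> 0"
    using AB by (auto simp: n_def zero_prod_def)
  have "n \<bullet> dLog (?z, ?w) v = 0" if "v \<in> tangent_vectors (curve f) (?z, ?w)" for v
  proof -
    show ?thesis
      using real_ratio_kernel[OF ker[OF that] rho]
      by (cases "?A = 0") (simp_all add: n_def dLog_eq[OF zw])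
  qed
  then have "dLog (?z, ?w) ` tangent_vectors (curve f) (?z, ?w) \<subseteq> {x. n \<bullet> x = 0}"
    by blast
  then have "dim (dLog (?z, ?w) ` tangent_vectors (curve f) (?z, ?w)) \<le> dim {x. n \<bullet> x = 0}"
    by (rule dim_subset)
  also have "\<dots> < 2"
    using dim_hyperplane[OF \<open>n \<noteq> 0\<close>] by simp
  finally show ?thesis by (simp add: complex_coords_def)
qed

text \<open>Membership in the critical locus is a rank condition on \<open>dLog\<close> over velocities of paths. It is
  decided by \<open>\<rho>\<close>: these velocities have images spanning the plane if \<open>\<rho> \<noteq> 0\<close> and images on a line
  through the origin if \<open>\<rho> = 0\<close>.\<close>

lemma Crit_complex_coords_iff:
  assumes "smooth_curve f"
  shows "complex_coords q \<in> Crit f \<longleftrightarrow> crit_eqs f q"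
proof
  assume "crit_eqs f q"
  then show "complex_coords q \<in> Crit f"
    using critical_tangent_image_dim
    by (auto simp: Crit_def curve_complex_coords crit_eqs_def torus_coords_def)
next
  assume Crit: "complex_coords q \<in> Crit f"
  then have q: "complex_coords q \<in> curve f"
    and dim: "dim (dLog (complex_coords q) ` tangent_vectors (curve f) (complex_coords q)) < 2"
    by (auto simp: Crit_def)
  have "rho f q = 0"
  proof (rule ccontr)
    assume "rho f q \<noteq> 0"
    from noncritical_tangent_image[OF q this]
    have "(Basis :: (real \<times> real) set) \<subseteq>
        dLog (complex_coords q) ` tangent_vectors (curve f) (complex_coords q)"
      by (auto simp: Basis_prod_def)
    from dim_subset[OF this] dim show False
      by (simp add: dim_eq_card_independent[OF independent_Basis])
  qed
  moreover have "Afun f q \<noteq> 0 \<or> Bfun f q \<noteq> 0" "zc q \<noteq> 0" "wc q \<noteq> 0"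
    using assms q unfolding smooth_curve_def
    by (auto simp: Afun_def Bfun_def curve_def complex_coords_def)
  ultimately show "crit_eqs f q"
    using q by (auto simp: crit_eqs_def curve_complex_coords)
qed

section \<open>Critical arcs away from degenerate lifts\<close>

lemma G_component: "G f q $ 1 = ufun f q" "G f q $ 2 = vfun f q" "G f q $ 3 = rho f q"
  by (simp_all add: G_def)

lemma G_elementary: "elementary_on torus_coords (\<lambda>q. G f q $ i)"
  using exhaust_3[of i] by (auto simp: G_component ufun_elementary vfun_elementary rho_elementary)

lemma DG_has_derivative:
  "q \<in> torus_coords \<Longrightarrow> (G f has_derivative (\<lambda>h. DG f q *v h)) (at q)"
  unfolding DG_def by (rule elementary_on_vec_has_derivative[OF open_torus_coords _ G_elementary])

text \<open>An arc that is the whole critical locus near \<open>q\<close> and that is parametrized by a linear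
  functional \<open>T\<close> of its logarithmic image. The parametrization by \<open>T\<close> is what makes the image an
  embedded arc: \<open>T\<close> recovers the parameter, and it forces nonzero velocity.\<close>

definition critical_arc ::
    "laurent \<Rightarrow> real^4 \<Rightarrow> (real \<times> real \<Rightarrow> real) \<Rightarrow> real \<Rightarrow> (real \<Rightarrow> complex \<times> complex) \<Rightarrow> bool" where
  "critical_arc f q T \<epsilon> \<gamma> \<longleftrightarrow>
     bounded_linear T \<and> 0 < \<epsilon> \<and> \<gamma> 0 = complex_coords q \<and>
     smooth_path_on \<gamma> {-\<epsilon><..<\<epsilon>} \<and> smooth_path_on (\<lambda>t. Log (\<gamma> t)) {-\<epsilon><..<\<epsilon>} \<and>
     \<gamma> ` {-\<epsilon><..<\<epsilon>} \<subseteq> Crit f \<and>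
     (\<forall>t\<in>{-\<epsilon><..<\<epsilon>}. T (Log (\<gamma> t)) = T (Log (complex_coords q)) + t) \<and>
     (\<exists>V. open V \<and> complex_coords q \<in> V \<and> V \<inter> Crit f \<subseteq> \<gamma> ` {-\<epsilon><..<\<epsilon>})"

lemma critical_arcD:
  assumes "critical_arc f q T \<epsilon> \<gamma>"
  shows "bounded_linear T" "0 < \<epsilon>" "\<gamma> 0 = complex_coords q"
    "smooth_path_on \<gamma> {-\<epsilon><..<\<epsilon>}" "smooth_path_on (\<lambda>t. Log (\<gamma> t)) {-\<epsilon><..<\<epsilon>}"
    "\<gamma> ` {-\<epsilon><..<\<epsilon>} \<subseteq> Crit f"
    "\<exists>V. open V \<and> complex_coords q \<in> V \<and> V \<inter> Crit f \<subseteq> \<gamma> ` {-\<epsilon><..<\<epsilon>}"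
    "strict_mono_on {-\<epsilon><..<\<epsilon>} (\<lambda>t. T (Log (\<gamma> t)))"
    "t \<in> {-\<epsilon><..<\<epsilon>} \<Longrightarrow> vector_derivative (\<lambda>t. Log (\<gamma> t)) (at t) \<noteq> 0"
proof -
  show T: "bounded_linear T" and "0 < \<epsilon>" "\<gamma> 0 = complex_coords q"
    "smooth_path_on \<gamma> {-\<epsilon><..<\<epsilon>}" and sm: "smooth_path_on (\<lambda>t. Log (\<gamma> t)) {-\<epsilon><..<\<epsilon>}"
    and "\<gamma> ` {-\<epsilon><..<\<epsilon>} \<subseteq> Crit f"
    "\<exists>V. open V \<and> complex_coords q \<in> V \<and> V \<inter> Crit f \<subseteq> \<gamma> ` {-\<epsilon><..<\<epsilon>}"
    using assms by (auto simp: critical_arc_def)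
  have unit_speed: "T (Log (\<gamma> t)) = T (Log (complex_coords q)) + t" if "t \<in> {-\<epsilon><..<\<epsilon>}" for t
    using assms that by (auto simp: critical_arc_def)
  then show "strict_mono_on {-\<epsilon><..<\<epsilon>} (\<lambda>t. T (Log (\<gamma> t)))"
    by (intro strict_mono_onI) simp
  assume t: "t \<in> {-\<epsilon><..<\<epsilon>}"
  obtain v where v: "((\<lambda>t. Log (\<gamma> t)) has_vector_derivative v) (at t)"
    by (rule smooth_path_on_has_derivative[OF sm t])
  have "((\<lambda>t. T (Log (\<gamma> t))) has_vector_derivative T v) (at t)"
    by (rule bounded_linear.has_vector_derivative[OF T v])
  moreover have "((\<lambda>t. T (Log (\<gamma> t))) has_vector_derivative 1) (at t)"
  proof (rule has_vector_derivative_transform_within_open)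
    show "((\<lambda>t. T (Log (complex_coords q)) + t) has_vector_derivative 1) (at t)"
      by (auto intro!: derivative_eq_intros)
    show "open {-\<epsilon><..<\<epsilon>}" by simp
  qed (use t unit_speed in simp_all)
  ultimately have "T v = 1"
    using vector_derivative_unique_at by blast
  then show "vector_derivative (\<lambda>t. Log (\<gamma> t)) (at t) \<noteq> 0"
    using linear_0[OF bounded_linear.linear[OF T]] vector_derivative_at[OF v] by auto
qed

text \<open>The function \<open>T \<circ> Log\<close> completes \<open>(u, v, \<rho>)\<close> to local coordinates on \<open>\<real>\<^sup>4\<close>. In these
  coordinates the critical locus near \<open>q\<close> is the last coordinate line, and the coordinate
  \<open>T \<circ> Log\<close> itself is the parameter on it.\<close>

lemma critical_arc_transversal:
  fixes T :: "real \<times> real \<Rightarrow> real"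
  assumes smooth: "smooth_curve f" and crit: "crit_eqs f q"
    and T: "bounded_linear T"
    and el: "elementary_on torus_coords (\<lambda>q. T (Log (complex_coords q)))"
    and der: "((\<lambda>q. T (Log (complex_coords q))) has_derivative (\<lambda>h. r \<bullet> h)) (at q)"
    and det: "det (append_row (DG f q) r) \<noteq> 0"
  shows "\<exists>\<epsilon> \<gamma>. critical_arc f q T \<epsilon> \<gamma>"
proof -
  define l where "l = (\<lambda>q. T (Log (complex_coords q)))"
  define \<Phi> :: "real^4 \<Rightarrow> real^4" where
    "\<Phi> = (\<lambda>q. vector [ufun f q, vfun f q, rho f q, l q])"
  have \<Phi>_el: "elementary_on torus_coords (\<lambda>q. \<Phi> q $ i)" for i
    using exhaust_4[of i] el
    by (auto simp: \<Phi>_def l_def ufun_elementary vfun_elementary rho_elementary)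
  have q_torus: "q \<in> torus_coords" and G0: "ufun f q = 0" "vfun f q = 0" "rho f q = 0"
    using crit by (auto simp: crit_eqs_def torus_coords_def)
  let ?M = "append_row (DG f q) r"
  have comp: "((\<lambda>q. G f q $ i) has_derivative (\<lambda>h. DG f q $ i \<bullet> h)) (at q)" for i
    using bounded_linear.has_derivative[OF bounded_linear_vec_nth DG_has_derivative[OF q_torus]]
    by (simp add: matrix_vector_mul_component)
  have "((\<lambda>x. \<Phi> x \<bullet> b) has_derivative (\<lambda>x. (?M *v x) \<bullet> b)) (at q)" if b: "b \<in> Basis" for b
  proof -
    obtain k where k: "b = axis k 1"
      using b by (auto simp: Basis_vec_def)
    have "((\<lambda>x. \<Phi> x $ k) has_derivative (\<lambda>x. ?M $ k \<bullet> x)) (at q)"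
      using exhaust_4[of k] comp[of 1] comp[of 2] comp[of 3] der
      by (auto simp: \<Phi>_def l_def append_row_def G_component)
    then show ?thesis
      by (simp add: k inner_axis matrix_vector_mul_component)
  qed
  then have \<Phi>_der: "(\<Phi> has_derivative (\<lambda>h. ?M *v h)) (at q)"
    by (subst has_derivative_componentwise_within) blast
  have "axis 4 1 \<noteq> (0 :: real^4)"
    by (simp add: axis_eq_0_iff)
  obtain \<epsilon> \<gamma> where \<gamma>: "0 < \<epsilon>" "\<gamma> 0 = q"
    "\<And>t. t \<in> {-\<epsilon><..<\<epsilon>} \<Longrightarrow> \<gamma> t \<in> torus_coords"
    "\<And>t. t \<in> {-\<epsilon><..<\<epsilon>} \<Longrightarrow> \<Phi> (\<gamma> t) = \<Phi> q + t *\<^sub>R axis 4 1"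
    "\<And>g. elementary_on torus_coords g \<Longrightarrow> smooth_path_on (\<lambda>t. g (\<gamma> t)) {-\<epsilon><..<\<epsilon>}"
    "\<exists>V. open V \<and> q \<in> V \<and>
        (\<forall>q'\<in>V. \<forall>t. \<Phi> q' = \<Phi> q + t *\<^sub>R axis 4 1 \<longrightarrow> \<bar>t\<bar> < \<epsilon> \<and> q' = \<gamma> t)"
    by (rule straightening_path[OF open_torus_coords q_torus \<Phi>_el \<Phi>_der det \<open>axis 4 1 \<noteq> 0\<close>]) blast
  let ?c = "\<lambda>t. complex_coords (\<gamma> t)"
  have on_axis: "\<Phi> q' = \<Phi> q + t *\<^sub>R axis 4 1 \<longleftrightarrow>
      ufun f q' = 0 \<and> vfun f q' = 0 \<and> rho f q' = 0 \<and> l q' = l q + t" for q' t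
    using G0 by (auto simp: \<Phi>_def vec_eq_iff forall_4 axis_def)
  have Crit: "?c t \<in> Crit f" "l (\<gamma> t) = l q + t" if "t \<in> {-\<epsilon><..<\<epsilon>}" for t
  proof -
    have *: "ufun f (\<gamma> t) = 0" "vfun f (\<gamma> t) = 0" "rho f (\<gamma> t) = 0" "l (\<gamma> t) = l q + t"
      using \<gamma>(4)[OF that] unfolding on_axis by auto
    then have "?c t \<in> curve f"
      using \<gamma>(3)[OF that] by (simp add: curve_complex_coords)
    then have "crit_eqs f (\<gamma> t)"
      using smooth * \<gamma>(3)[OF that] unfolding smooth_curve_def crit_eqs_def
      by (auto simp: complex_coords_def torus_coords_def Afun_def Bfun_def)
    then show "?c t \<in> Crit f" "l (\<gamma> t) = l q + t"
      using * by (simp_all add: Crit_complex_coords_iff[OF smooth])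
  qed
  have sm: "smooth_path_on ?c {-\<epsilon><..<\<epsilon>}"
    by (rule complex_coords_path_smooth[OF \<gamma>(5)])
  have smL: "smooth_path_on (\<lambda>t. Log (?c t)) {-\<epsilon><..<\<epsilon>}"
    unfolding Log_complex_coords by (intro smooth_path_on_Pair \<gamma>(5) ln_cmod_elementary)
  have nbhd: "\<exists>V. open V \<and> complex_coords q \<in> V \<and> V \<inter> Crit f \<subseteq> ?c ` {-\<epsilon><..<\<epsilon>}"
  proof -
    obtain V where V: "open V" "q \<in> V"
      "\<And>q' t. q' \<in> V \<Longrightarrow> \<Phi> q' = \<Phi> q + t *\<^sub>R axis 4 1 \<Longrightarrow> \<bar>t\<bar> < \<epsilon> \<and> q' = \<gamma> t"
      using \<gamma>(6) by meson
    show ?thesis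
    proof (intro exI[of _ "real_coords -` V"] conjI subsetI)
      show "open (real_coords -` V)"
        by (rule open_vimage[OF V(1) linear_continuous_on[OF bounded_linear_real_coords]])
      show "complex_coords q \<in> real_coords -` V" using V(2) by simp
      fix p assume p: "p \<in> real_coords -` V \<inter> Crit f"
      define q' where "q' = real_coords p"
      have q': "p = complex_coords q'" "q' \<in> V" using p by (simp_all add: q'_def)
      then have "crit_eqs f q'" using p Crit_complex_coords_iff[OF smooth] by auto
      then have "\<Phi> q' = \<Phi> q + (l q' - l q) *\<^sub>R axis 4 1"
        unfolding on_axis by (simp add: crit_eqs_def)
      from V(3)[OF q'(2) this] show "p \<in> ?c ` {-\<epsilon><..<\<epsilon>}"
        unfolding q'(1) by (metis abs_less_iff greaterThanLessThan_iff image_eqI minus_less_iff)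
    qed
  qed
  show ?thesis
    unfolding critical_arc_def using T \<gamma>(1,2) sm smL Crit nbhd
    by (intro exI[of _ \<epsilon>] exI[of _ ?c]) (auto simp: l_def)
qed

text \<open>If \<open>J\<^sub>z\<close> or \<open>J\<^sub>w\<close> is nonzero, then \<open>log |z|\<close> or \<open>log |w|\<close> completes \<open>(u, v, \<rho>)\<close> to local
  coordinates, because the rows \<open>\<alpha>\<close> and \<open>\<beta>\<close> are the differentials of these two functions.\<close>

lemma critical_arc_off_system2:
  assumes smooth: "smooth_curve f" and crit: "crit_eqs f q" and q: "q \<notin> system2 f"
  shows "\<exists>T \<epsilon> \<gamma>. critical_arc f q T \<epsilon> \<gamma>"
proof -
  have q_torus: "q \<in> torus_coords"
    using crit by (auto simp: crit_eqs_def torus_coords_def)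
  have rows: "alpha_row q \<bullet> h = Re (zc h / zc q)" "beta_row q \<bullet> h = Re (wc h / wc q)" for h
    by (simp_all add: alpha_row_def beta_row_def inner_vec_def sum_4 Re_divide zc_def wc_def
        Rsq_def Ssq_def add_divide_distrib mult.commute)
  have "Jz f q \<noteq> 0 \<or> Jw f q \<noteq> 0"
    using q crit by (auto simp: system2_def Jz_tilde_def Jw_tilde_def)
  then show ?thesis
  proof
    assume "Jz f q \<noteq> 0"
    then have det: "det (append_row (DG f q) (alpha_row q)) \<noteq> 0" by (simp add: Jz_def)
    have el: "elementary_on torus_coords (\<lambda>q. fst (Log (complex_coords q)))"
      by (simp add: Log_complex_coords ln_cmod_elementary)
    have der: "((\<lambda>q. fst (Log (complex_coords q))) has_derivative (\<lambda>h. alpha_row q \<bullet> h)) (at q)"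
      by (simp add: Log_complex_coords rows ln_cmod_coords_has_derivative[OF q_torus])
    show ?thesis
      using critical_arc_transversal[OF smooth crit bounded_linear_fst el der det] by blast
  next
    assume "Jw f q \<noteq> 0"
    then have det: "det (append_row (DG f q) (beta_row q)) \<noteq> 0" by (simp add: Jw_def)
    have el: "elementary_on torus_coords (\<lambda>q. snd (Log (complex_coords q)))"
      by (simp add: Log_complex_coords ln_cmod_elementary)
    have der: "((\<lambda>q. snd (Log (complex_coords q))) has_derivative (\<lambda>h. beta_row q \<bullet> h)) (at q)"
      by (simp add: Log_complex_coords rows ln_cmod_coords_has_derivative[OF q_torus])
    show ?thesis
      using critical_arc_transversal[OF smooth crit bounded_linear_snd el der det] by blast
  qed
qed

section \<open>Embedded arcs and germs\<close>

text \<open>A real function \<open>\<psi>\<close> that separates the points of the path reduces the continuity of the inverse to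
  the one-dimensional case, where an injective continuous map is open.\<close>

lemma path_homeomorphism:
  fixes \<gamma> :: "real \<Rightarrow> 'a::topological_space" and \<psi> :: "'a \<Rightarrow> real"
  assumes "open J" "continuous_on J \<gamma>" "continuous_on (\<gamma> ` J) \<psi>" "inj_on (\<lambda>t. \<psi> (\<gamma> t)) J"
  shows "\<exists>g. homeomorphism J (\<gamma> ` J) \<gamma> g"
proof -
  have "continuous_on J (\<lambda>t. \<psi> (\<gamma> t))"
    by (rule continuous_on_compose2[OF assms(3,2)]) simp
  then obtain k where k: "homeomorphism J ((\<lambda>t. \<psi> (\<gamma> t)) ` J) (\<lambda>t. \<psi> (\<gamma> t)) k"
    using invariance_of_domain_homeomorphism[of J "\<lambda>t. \<psi> (\<gamma> t)"] assms(1,4) by auto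
  have "homeomorphism J (\<gamma> ` J) \<gamma> (\<lambda>x. k (\<psi> x))"
  proof
    show "continuous_on (\<gamma> ` J) (\<lambda>x. k (\<psi> x))"
      by (rule continuous_on_compose2[OF homeomorphism_cont2[OF k] assms(3)]) auto
  qed (use k assms(2) in \<open>auto simp: homeomorphism_def\<close>)
  then show ?thesis by blast
qed

lemma smooth_arc_embedded:
  fixes \<gamma> :: "real \<Rightarrow> 'a::euclidean_space" and \<psi> :: "'a \<Rightarrow> real"
  assumes "smooth_path_on \<gamma> {a<..<b}" "continuous_on (\<gamma> ` {a<..<b}) \<psi>"
    "inj_on (\<lambda>t. \<psi> (\<gamma> t)) {a<..<b}" "\<And>t. t \<in> {a<..<b} \<Longrightarrow> vector_derivative \<gamma> (at t) \<noteq> 0"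
  shows "smooth_embedded_curve (\<gamma> ` {a<..<b})"
proof -
  obtain g where "homeomorphism {a<..<b} (\<gamma> ` {a<..<b}) \<gamma> g"
    using path_homeomorphism[OF _ smooth_path_on_continuous[OF assms(1)] assms(2,3)] by auto
  then show ?thesis
    unfolding smooth_embedded_curve_def using assms(1,4)
    by (intro ballI exI[of _ UNIV] exI[of _ a] exI[of _ b] exI[of _ \<gamma>] exI[of _ g]) auto
qed

text \<open>The arc may leave \<open>V\<close>, so \<open>X\<close> is cut down to the part of \<open>V\<close> between two level sets of \<open>\<psi>\<close>:
  by monotonicity of \<open>\<psi>\<close> along the arc, this part of \<open>X\<close> is exactly one parameter interval.\<close>

lemma smooth_curve_near_arc:
  fixes \<gamma> :: "real \<Rightarrow> 'a::euclidean_space" and \<psi> :: "'a \<Rightarrow> real"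
  assumes \<delta>: "0 < \<delta>" and sm: "smooth_path_on \<gamma> {-\<delta><..<\<delta>}"
    and reg: "\<And>t. t \<in> {-\<delta><..<\<delta>} \<Longrightarrow> vector_derivative \<gamma> (at t) \<noteq> 0"
    and V: "open V" "\<gamma> 0 \<in> V" "continuous_on V \<psi>" "V \<inter> X \<subseteq> \<gamma> ` {-\<delta><..<\<delta>}"
    and X: "\<gamma> ` {-\<delta><..<\<delta>} \<subseteq> X"
    and mono: "strict_mono_on {-\<delta><..<\<delta>} (\<lambda>t. \<psi> (\<gamma> t))"
  shows "smooth_curve_near X (\<gamma> 0)"
proof -
  let ?J = "{-\<delta><..<\<delta>}"
  have cont: "continuous_on ?J \<gamma>" by (rule smooth_path_on_continuous[OF sm])
  have "open (?J \<inter> \<gamma> -` V)"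
    by (rule continuous_open_preimage[OF cont _ V(1)]) simp
  moreover have "0 \<in> ?J \<inter> \<gamma> -` V" using \<delta> V(2) by simp
  ultimately obtain d where d: "0 < d" "ball 0 d \<subseteq> ?J \<inter> \<gamma> -` V"
    using openE by blast
  define \<eta> where "\<eta> = d / 2"
  have \<eta>: "0 < \<eta>" "{-\<eta>..\<eta>} \<subseteq> ball 0 d"
    using d(1) by (auto simp: \<eta>_def)
  then have sub: "{-\<eta>..\<eta>} \<subseteq> ?J" "\<gamma> ` {-\<eta>..\<eta>} \<subseteq> V"
    using d(2) by blast+
  then have inner: "{-\<eta><..<\<eta>} \<subseteq> ?J" "\<gamma> ` {-\<eta><..<\<eta>} \<subseteq> V"
    using greaterThanLessThan_subseteq_atLeastAtMost_iff[of "-\<eta>" \<eta> "-\<eta>" \<eta>] by blast+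
  have ends: "-\<eta> \<in> ?J" "\<eta> \<in> ?J" using \<eta>(1) by (auto intro!: subsetD[OF sub(1)] simp del: greaterThanLessThan_iff)
  define U where "U = V \<inter> \<psi> -` {\<psi> (\<gamma> (-\<eta>))<..<\<psi> (\<gamma> \<eta>)}"
  have less: "\<psi> (\<gamma> s) < \<psi> (\<gamma> t) \<longleftrightarrow> s < t" if "s \<in> ?J" "t \<in> ?J" for s t
    by (rule strict_mono_on_less[OF mono that])
  have "open U"
    unfolding U_def by (rule continuous_open_preimage[OF V(3,1)]) simp
  moreover have UX: "U \<inter> X = \<gamma> ` {-\<eta><..<\<eta>}"
  proof (intro equalityI subsetI)
    fix x assume x: "x \<in> U \<inter> X"
    then obtain t where t: "t \<in> ?J" "x = \<gamma> t" using V(4) by (auto simp: U_def)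
    then have "t \<in> {-\<eta><..<\<eta>}"
      using x less[OF ends(1) t(1)] less[OF t(1) ends(2)] by (simp add: U_def)
    then show "x \<in> \<gamma> ` {-\<eta><..<\<eta>}" using t by blast
  next
    fix x assume "x \<in> \<gamma> ` {-\<eta><..<\<eta>}"
    then obtain t where t: "t \<in> {-\<eta><..<\<eta>}" "x = \<gamma> t" by blast
    then have tJ: "t \<in> ?J" using inner(1) by blast
    then have "x \<in> X" using X t by blast
    moreover have "x \<in> U"
      using t inner(2) less[OF ends(1) tJ] less[OF tJ ends(2)] by (auto simp: U_def)
    ultimately show "x \<in> U \<inter> X" by blast
  qed
  moreover have "\<gamma> 0 \<in> U" using UX \<eta>(1) by auto
  moreover have "smooth_embedded_curve (\<gamma> ` {-\<eta><..<\<eta>})"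
  proof (rule smooth_arc_embedded[of _ _ _ \<psi>])
    show "smooth_path_on \<gamma> {-\<eta><..<\<eta>}"
      by (rule smooth_path_on_subset[OF sm inner(1)])
    show "continuous_on (\<gamma> ` {-\<eta><..<\<eta>}) \<psi>"
      by (rule continuous_on_subset[OF V(3) inner(2)])
    show "inj_on (\<lambda>t. \<psi> (\<gamma> t)) {-\<eta><..<\<eta>}"
      by (rule inj_on_subset[OF strict_mono_on_imp_inj_on[OF mono] inner(1)])
    show "vector_derivative \<gamma> (at t) \<noteq> 0" if "t \<in> {-\<eta><..<\<eta>}" for t
      by (rule reg[OF subsetD[OF inner(1) that]])
  qed
  ultimately show ?thesis
    unfolding smooth_curve_near_def by (intro exI[of _ U]) simp
qed

text \<open>A one-dimensional invariance of domain: an injective path in an embedded curve, read in a local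
  parameter of the curve, is an injective continuous map between real intervals, hence open. So the
  path fills a neighborhood of its midpoint in the curve.\<close>

lemma arc_fills_smooth_curve:
  fixes c :: "real \<Rightarrow> 'a::euclidean_space"
  assumes X: "smooth_curve_near X (c 0)" and \<eta>: "0 < \<eta>"
    and c: "continuous_on {-\<eta><..<\<eta>} c" "inj_on c {-\<eta><..<\<eta>}" "c ` {-\<eta><..<\<eta>} \<subseteq> X"
  shows "\<exists>N. open N \<and> c 0 \<in> N \<and> N \<inter> X \<subseteq> c ` {-\<eta><..<\<eta>}"
proof -
  let ?J = "{-\<eta><..<\<eta>}"
  obtain W where W: "open W" "c 0 \<in> W" "smooth_embedded_curve (W \<inter> X)"
    using X unfolding smooth_curve_near_def by blast
  have "c 0 \<in> W \<inter> X" using W(2) c(3) \<eta> by auto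
  from bspec[OF W(3)[unfolded smooth_embedded_curve_def] this]
  obtain V and a b :: real and \<gamma> g where V: "open V" "c 0 \<in> V"
    and hom: "homeomorphism {a<..<b} (W \<inter> X \<inter> V) \<gamma> g"
    by blast
  define K where "K = ?J \<inter> c -` (W \<inter> V)"
  have K: "open K" "0 \<in> K" "K \<subseteq> ?J"
    unfolding K_def using continuous_open_preimage[OF c(1), of "W \<inter> V"] W V \<eta> by auto
  have cK: "c ` K \<subseteq> W \<inter> X \<inter> V" using c(3) by (auto simp: K_def)
  have g\<gamma>: "\<gamma> (g x) = x" if "x \<in> W \<inter> X \<inter> V" for x
    using hom that by (simp add: homeomorphism_def)
  have "open ((\<lambda>t. g (c t)) ` K)"
  proof (rule invariance_of_domain)
    show "continuous_on K (\<lambda>t. g (c t))"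
      by (rule continuous_on_compose2[OF homeomorphism_cont2[OF hom] continuous_on_subset[OF c(1) K(3)] cK])
    show "inj_on (\<lambda>t. g (c t)) K"
    proof (rule inj_onI)
      fix s t assume st: "s \<in> K" "t \<in> K" "g (c s) = g (c t)"
      then have "c s = c t" using g\<gamma> cK by (metis image_subset_iff)
      then show "s = t" using c(2) K(3) st by (meson inj_onD subsetD)
    qed
  qed (rule K(1))
  moreover have "(\<lambda>t. g (c t)) ` K \<subseteq> {a<..<b}"
    using cK hom unfolding homeomorphism_def by blast
  ultimately have "openin (top_of_set {a<..<b}) ((\<lambda>t. g (c t)) ` K)"
    by (simp add: openin_open_eq)
  then have "openin (top_of_set (W \<inter> X \<inter> V)) (\<gamma> ` (\<lambda>t. g (c t)) ` K)"
    by (rule homeomorphism_imp_open_map[OF hom])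
  moreover have "\<gamma> ` (\<lambda>t. g (c t)) ` K = c ` K"
    using g\<gamma> cK by (force simp: image_image)
  ultimately obtain T where T: "open T" "c ` K = (W \<inter> X \<inter> V) \<inter> T"
    by (auto simp: openin_open)
  show ?thesis
  proof (intro exI[of _ "W \<inter> V \<inter> T"] conjI)
    show "open (W \<inter> V \<inter> T)" using W V T by auto
    show "c 0 \<in> W \<inter> V \<inter> T" using T(2) K(2) by blast
    show "W \<inter> V \<inter> T \<inter> X \<subseteq> c ` ?J" using T(2) K(3) by blast
  qed
qed

lemma set_germ_eqI:
  assumes "open N" "p \<in> N" "N \<inter> X = N \<inter> Y"
  shows "set_germ p X = set_germ p Y"
proof -
  have "Z \<in> set_germ p B" if AB: "N \<inter> A = N \<inter> B" and Z: "Z \<in> set_germ p A" for A B Z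
  proof -
    obtain W where "open W" "p \<in> W" "W \<inter> A = W \<inter> Z"
      using Z by (auto simp: set_germ_def)
    then show ?thesis
      unfolding set_germ_def using assms(1,2) AB
      by (intro CollectI exI[of _ "N \<inter> W"]) blast
  qed
  with assms(3) show ?thesis by blast
qed

text \<open>If the image germ does not depend on the neighborhood at all, the definite description in
  \<^const>\<open>contour_branch\<close> is determined, since any two candidates agree on a common
  neighborhood.\<close>

lemma contour_branch_eqI:
  assumes "\<And>U. open U \<Longrightarrow> q \<in> U \<Longrightarrow> set_germ (Log q) (Log ` (U \<inter> Crit f)) = g"
  shows "contour_branch f q = g"
  unfolding contour_branch_def
proof (rule the_equality)
  show "\<exists>U\<^sub>0. open U\<^sub>0 \<and> q \<in> U\<^sub>0 \<and>
      (\<forall>U. open U \<and> q \<in> U \<and> U \<subseteq> U\<^sub>0 \<longrightarrow> set_germ (Log q) (Log ` (U \<inter> Crit f)) = g)"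
    using assms by (intro exI[of _ UNIV]) auto
next
  fix g' assume "\<exists>U\<^sub>0. open U\<^sub>0 \<and> q \<in> U\<^sub>0 \<and>
      (\<forall>U. open U \<and> q \<in> U \<and> U \<subseteq> U\<^sub>0 \<longrightarrow> set_germ (Log q) (Log ` (U \<inter> Crit f)) = g')"
  then show "g' = g" using assms by (metis order_refl)
qed

text \<open>Critical points outside a neighborhood \<open>U\<close> of the only lift have an image that is closed near \<open>p\<close>,
  because proper maps are closed, and that misses \<open>p\<close>. So near \<open>p\<close> the contour comes from \<open>U\<close>.\<close>

lemma proper_unique_lift_localizes:
  assumes proper: "locally_proper_at f p" and fiber: "crit_fiber f p = {q}"
    and U: "open U" "q \<in> U"
  shows "\<exists>N. open N \<and> p \<in> N \<and> N \<inter> contour f \<subseteq> Log ` (U \<inter> Crit f)"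
proof -
  obtain W \<Omega> W' where W: "open W" "p \<in> W" "crit_fiber f p \<subseteq> \<Omega>"
    "openin (top_of_set (Crit f)) \<Omega>"
    "proper_map (top_of_set \<Omega>) (top_of_set W) Log"
    "open W'" "p \<in> W'" "W' \<subseteq> W" "\<And>q. q \<in> Crit f \<Longrightarrow> Log q \<in> W' \<Longrightarrow> q \<in> \<Omega>"
    using proper unfolding locally_proper_at_def by blast
  have "closedin (top_of_set \<Omega>) (\<Omega> - U)"
    using U(1) by (metis Diff_Int_distrib Int_absorb closedin_closed_Int closed_Compl Diff_eq)
  then have "closedin (top_of_set W) (Log ` (\<Omega> - U))"
    using W(5) by (auto simp: proper_map_def closed_map_def)
  then obtain T where T: "closed T" "Log ` (\<Omega> - U) = W \<inter> T"
    by (auto simp: closedin_closed)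
  have "\<Omega> \<subseteq> Crit f" using W(4) openin_imp_subset by blast
  then have "p \<notin> Log ` (\<Omega> - U)"
    using fiber U(2) by (auto simp: crit_fiber_def)
  show ?thesis
  proof (intro exI[of _ "W' \<inter> - T"] conjI)
    show "open (W' \<inter> - T)" using W(6) T(1) by auto
    show "p \<in> W' \<inter> - T" using W(2,7) T(2) \<open>p \<notin> Log ` (\<Omega> - U)\<close> by blast
    show "W' \<inter> - T \<inter> contour f \<subseteq> Log ` (U \<inter> Crit f)"
    proof
      fix y assume y: "y \<in> W' \<inter> - T \<inter> contour f"
      then obtain r where r: "r \<in> Crit f" "y = Log r" by (auto simp: contour_def)
      then have "r \<in> \<Omega>" using W(9) y by blast
      moreover have "r \<in> U"
      proof (rule ccontr)
        assume "r \<notin> U"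
        then have "y \<in> W \<inter> T" unfolding T(2)[symmetric] using r \<open>r \<in> \<Omega>\<close> by blast
        then show False using y by blast
      qed
      ultimately show "y \<in> Log ` (U \<inter> Crit f)" using r by blast
    qed
  qed
qed

section \<open>Singular points of the contour\<close>

lemma Crit_subset_curve: "Crit f \<subseteq> curve f"
  by (auto simp: Crit_def)

lemma continuous_on_Log: "continuous_on {p. fst p \<noteq> 0 \<and> snd p \<noteq> 0} Log"
  unfolding Log_def case_prod_beta' by (intro continuous_intros) auto

lemma open_torus: "open {p :: complex \<times> complex. fst p \<noteq> 0 \<and> snd p \<noteq> 0}"
  by (intro open_Collect_conj open_Collect_neq continuous_intros)

text \<open>The arc is an embedded curve since \<open>T \<circ> Log\<close> is monotone on it, and the velocity of its
  logarithmic image is the nonzero value of \<open>dLog\<close> required of a nondegenerate lift.\<close>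

lemma nondegenerate_off_system2:
  assumes smooth: "smooth_curve f" and crit: "crit_eqs f q" and q: "q \<notin> system2 f"
  shows "nondegenerate_lift f (complex_coords q)"
proof -
  obtain T \<delta> \<gamma> where arc: "critical_arc f q T \<delta> \<gamma>"
    using critical_arc_off_system2[OF assms] by blast
  note \<gamma> = critical_arcD[OF arc]
  have torus: "fst (\<gamma> t) \<noteq> 0" "snd (\<gamma> t) \<noteq> 0" if "t \<in> {-\<delta><..<\<delta>}" for t
  proof -
    have "\<gamma> t \<in> curve f" using \<gamma>(6) that Crit_subset_curve by blast
    then show "fst (\<gamma> t) \<noteq> 0" "snd (\<gamma> t) \<noteq> 0" by (auto simp: curve_def)
  qed
  have velocity: "\<exists>u. (\<gamma> has_vector_derivative u) (at t) \<and> dLog (\<gamma> t) u \<noteq> 0"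
    if t: "t \<in> {-\<delta><..<\<delta>}" for t
  proof -
    obtain u where u: "(\<gamma> has_vector_derivative u) (at t)"
      using smooth_path_on_has_derivative[OF \<gamma>(4) t] by blast
    from vector_derivative_at[OF Log_path_has_derivative[OF this torus[OF t]]] \<gamma>(9)[OF t] u
    show ?thesis by metis
  qed
  have reg: "vector_derivative \<gamma> (at t) \<noteq> 0" if t: "t \<in> {-\<delta><..<\<delta>}" for t
  proof -
    obtain u where u: "(\<gamma> has_vector_derivative u) (at t)" "dLog (\<gamma> t) u \<noteq> 0"
      using velocity[OF t] by blast
    have "dLog (\<gamma> t) 0 = 0"
      using dLog_eq[OF torus[OF t], of 0] by (simp add: zero_prod_def)
    then show ?thesis using u vector_derivative_at[OF u(1)] by auto
  qed
  obtain V where V: "open V" "\<gamma> 0 \<in> V" "V \<inter> Crit f \<subseteq> \<gamma> ` {-\<delta><..<\<delta>}"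
    using \<gamma>(7) unfolding \<gamma>(3) by blast
  have "smooth_curve_near (Crit f) (\<gamma> 0)"
  proof (rule smooth_curve_near_arc[OF \<gamma>(2,4) reg, where \<psi> = "\<lambda>p. T (Log p)"])
    show "open (V \<inter> {p. fst p \<noteq> 0 \<and> snd p \<noteq> 0})"
      using V(1) open_torus by blast
    show "\<gamma> 0 \<in> V \<inter> {p. fst p \<noteq> 0 \<and> snd p \<noteq> 0}"
      using V(2) torus[of 0] \<gamma>(2) by simp
    show "continuous_on (V \<inter> {p. fst p \<noteq> 0 \<and> snd p \<noteq> 0}) (\<lambda>p. T (Log p))"
      by (intro bounded_linear.continuous_on[OF \<gamma>(1)] continuous_on_subset[OF continuous_on_Log]) blast
    show "V \<inter> {p. fst p \<noteq> 0 \<and> snd p \<noteq> 0} \<inter> Crit f \<subseteq> \<gamma> ` {-\<delta><..<\<delta>}"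
      using V(3) by blast
  qed (use \<gamma>(6,8) in auto)
  moreover obtain u where "(\<gamma> has_vector_derivative u) (at 0)" "dLog (\<gamma> 0) u \<noteq> 0"
    using velocity[of 0] \<gamma>(2) by auto
  moreover from this(1) have "u \<in> tangent_vectors (Crit f) (\<gamma> 0)"
    unfolding tangent_vectors_def using \<gamma>(2,4,6)
    by (intro CollectI exI[of _ \<gamma>] exI[of _ \<delta>]) auto
  moreover have "\<gamma> 0 \<in> Crit f"
    using \<gamma>(2,6) by auto
  ultimately show ?thesis
    unfolding \<gamma>(3)[symmetric] nondegenerate_lift_def by blast
qed

text \<open>By properness the contour near the image of the only lift is the logarithmic image of the
  critical arc, and that image is an embedded arc.\<close>

lemma contour_smooth_at_unique_immersed_lift:
  assumes smooth: "smooth_curve f" and crit: "crit_eqs f q" and q: "q \<notin> system2 f"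
    and proper: "locally_proper_at f (Log (complex_coords q))"
    and unique: "crit_fiber f (Log (complex_coords q)) = {complex_coords q}"
  shows "smooth_curve_near (contour f) (Log (complex_coords q))"
proof -
  obtain T \<delta> \<gamma> where arc: "critical_arc f q T \<delta> \<gamma>"
    using critical_arc_off_system2[OF smooth crit q] by blast
  note \<gamma> = critical_arcD[OF arc]
  obtain V where V: "open V" "complex_coords q \<in> V" "V \<inter> Crit f \<subseteq> \<gamma> ` {-\<delta><..<\<delta>}"
    using \<gamma>(7) by blast
  obtain N where N: "open N" "Log (complex_coords q) \<in> N"
    "N \<inter> contour f \<subseteq> Log ` (V \<inter> Crit f)"
    using proper_unique_lift_localizes[OF proper unique V(1,2)] by blast
  have "smooth_curve_near (contour f) (Log (\<gamma> 0))"
  proof (rule smooth_curve_near_arc[OF \<gamma>(2,5,9) N(1), where \<psi> = T])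
    show "Log (\<gamma> 0) \<in> N" using N(2) \<gamma>(3) by simp
    show "continuous_on N T" by (rule linear_continuous_on[OF \<gamma>(1)])
    show "N \<inter> contour f \<subseteq> (\<lambda>t. Log (\<gamma> t)) ` {-\<delta><..<\<delta>}"
      using N(3) V(3) by (force simp: image_image)
    show "(\<lambda>t. Log (\<gamma> t)) ` {-\<delta><..<\<delta>} \<subseteq> contour f"
      using \<gamma>(6) by (auto simp: contour_def)
  qed (use \<gamma>(8) in simp_all)
  then show ?thesis by (simp add: \<gamma>(3))
qed

text \<open>At a regular point of the contour, each lift off system (2) accounts for the whole germ of the
  contour: its branch is an arc inside a smooth curve, and such an arc fills the curve.\<close>

lemma contour_branch_eq_contour_germ:
  assumes smooth: "smooth_curve f" and crit: "crit_eqs f q" and q: "q \<notin> system2 f"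
    and regular: "smooth_curve_near (contour f) (Log (complex_coords q))"
  shows "contour_branch f (complex_coords q) = set_germ (Log (complex_coords q)) (contour f)"
proof (rule contour_branch_eqI)
  fix U assume U: "open U" "complex_coords q \<in> U"
  obtain T \<delta> \<gamma> where arc: "critical_arc f q T \<delta> \<gamma>"
    using critical_arc_off_system2[OF smooth crit q] by blast
  note \<gamma> = critical_arcD[OF arc]
  have "open ({-\<delta><..<\<delta>} \<inter> \<gamma> -` U)"
    by (rule continuous_open_preimage[OF smooth_path_on_continuous[OF \<gamma>(4)] _ U(1)]) simp
  moreover have "0 \<in> {-\<delta><..<\<delta>} \<inter> \<gamma> -` U" using \<gamma>(2,3) U(2) by simp
  ultimately obtain \<eta> where \<eta>: "0 < \<eta>" "ball 0 \<eta> \<subseteq> {-\<delta><..<\<delta>} \<inter> \<gamma> -` U"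
    using openE by blast
  have ball: "ball 0 \<eta> = {-\<eta><..<\<eta>}"
    by (simp add: ball_eq_greaterThanLessThan)
  have sub: "{-\<eta><..<\<eta>} \<subseteq> {-\<delta><..<\<delta>}" "\<gamma> ` {-\<eta><..<\<eta>} \<subseteq> U \<inter> Crit f"
    using \<eta>(2) \<gamma>(6) unfolding ball by blast+
  have "\<exists>N. open N \<and> Log (\<gamma> 0) \<in> N \<and> N \<inter> contour f \<subseteq> (\<lambda>t. Log (\<gamma> t)) ` {-\<eta><..<\<eta>}"
  proof (rule arc_fills_smooth_curve[where c = "\<lambda>t. Log (\<gamma> t)"])
    show "smooth_curve_near (contour f) (Log (\<gamma> 0))" using regular \<gamma>(3) by simp
    show "continuous_on {-\<eta><..<\<eta>} (\<lambda>t. Log (\<gamma> t))"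
      by (rule continuous_on_subset[OF smooth_path_on_continuous[OF \<gamma>(5)] sub(1)])
    show "inj_on (\<lambda>t. Log (\<gamma> t)) {-\<eta><..<\<eta>}"
      using inj_on_subset[OF strict_mono_on_imp_inj_on[OF \<gamma>(8)] sub(1)]
      by (auto simp: inj_on_def)
    show "(\<lambda>t. Log (\<gamma> t)) ` {-\<eta><..<\<eta>} \<subseteq> contour f"
      using sub(2) by (auto simp: contour_def)
  qed (rule \<eta>(1))
  then obtain N where N: "open N" "Log (\<gamma> 0) \<in> N"
    "N \<inter> contour f \<subseteq> (\<lambda>t. Log (\<gamma> t)) ` {-\<eta><..<\<eta>}"
    by blast
  show "set_germ (Log (complex_coords q)) (Log ` (U \<inter> Crit f)) =
      set_germ (Log (complex_coords q)) (contour f)"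
  proof (rule set_germ_eqI[OF N(1)])
    show "Log (complex_coords q) \<in> N" using N(2) \<gamma>(3) by simp
    have "(\<lambda>t. Log (\<gamma> t)) ` {-\<eta><..<\<eta>} \<subseteq> Log ` (U \<inter> Crit f)"
      using sub(2) by blast
    then show "N \<inter> Log ` (U \<inter> Crit f) = N \<inter> contour f"
      using N(3) unfolding contour_def by blast
  qed
qed

lemma Log_eq_half_log:
  "q \<in> torus_coords \<Longrightarrow> Log (complex_coords q) = half_log (Rsq q, Ssq q)"
  by (simp add: Log_complex_coords half_log_def Rsq_eq Ssq_eq torus_coords_def ln_realpow)

lemma crit_eqs_torus: "crit_eqs f q \<Longrightarrow> q \<in> torus_coords"
  by (simp add: crit_eqs_def torus_coords_def)

lemma Log_coords_eq_iff:
  assumes "q \<in> torus_coords" "q' \<in> torus_coords"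
  shows "Log (complex_coords q) = Log (complex_coords q') \<longleftrightarrow> Rsq q = Rsq q' \<and> Ssq q = Ssq q'"
  using assms by (simp add: Log_complex_coords Rsq_eq Ssq_eq torus_coords_def)

lemma contour_coords:
  assumes "smooth_curve f"
  shows "p \<in> contour f \<longleftrightarrow> (\<exists>q. crit_eqs f q \<and> p = half_log (Rsq q, Ssq q))"
  unfolding contour_def
  using Crit_complex_coords_iff[OF assms] Log_eq_half_log crit_eqs_torus
  by (metis (no_types, lifting) complex_real_coords imageE imageI)

text \<open>The argument is by contraposition: off systems (2) and (3) the point has exactly one lift, and
  \<open>Log\<close> immerses the critical arc through it. System (1) is covered as well, because the
  \<open>3 \<times> 3\<close> minors of \<open>DG\<close> are, up to sign, the cofactors along the last row of \<open>J\<^sub>z\<close> and of \<open>J\<^sub>w\<close>: a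
  nonzero \<open>J\<^sub>z\<close> or \<open>J\<^sub>w\<close> forces a nonzero minor.\<close>

lemma singular_contour_point_in_systems:
  assumes smooth: "smooth_curve f" and p: "p \<in> Sing_contour f" and proper: "locally_proper_at f p"
  shows "p \<in> half_log ` proj2 f \<or> p \<in> half_log ` proj3 f"
proof (rule ccontr)
  assume not: "\<not> ?thesis"
  obtain q where q: "crit_eqs f q" "p = half_log (Rsq q, Ssq q)"
    using p contour_coords[OF smooth] by (auto simp: Sing_contour_def)
  have Log_q: "p = Log (complex_coords q)"
    using q Log_eq_half_log crit_eqs_torus by metis
  have q2: "q \<notin> system2 f"
    using not q(2) by (auto simp: proj2_def)
  have unique: "q' = q" if "crit_eqs f q'" "Log (complex_coords q') = p" for q'
  proof (rule ccontr)
    assume "q' \<noteq> q"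
    then have "(q, q') \<in> system3 f"
      using that q(1) Log_coords_eq_iff[OF crit_eqs_torus[OF q(1)] crit_eqs_torus[OF that(1)]] Log_q
      by (auto simp: system3_def)
    then have "(Rsq q, Ssq q) \<in> proj3 f" by (force simp: proj3_def)
    then show False using not q(2) by blast
  qed
  have "crit_fiber f p = {complex_coords q}"
  proof (intro equalityI subsetI)
    fix r assume "r \<in> crit_fiber f p"
    then have "r \<in> Crit f" "Log r = p" by (auto simp: crit_fiber_def)
    then have "real_coords r = q"
      using unique[of "real_coords r"] Crit_complex_coords_iff[OF smooth, of "real_coords r"] by simp
    then show "r \<in> {complex_coords q}" by (metis complex_real_coords singletonI)
  next
    fix r assume "r \<in> {complex_coords q}"
    then show "r \<in> crit_fiber f p"
      using q(1) Log_q by (simp add: crit_fiber_def Crit_complex_coords_iff[OF smooth])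
  qed
  then have "smooth_curve_near (contour f) p"
    using contour_smooth_at_unique_immersed_lift[OF smooth q(1) q2] proper Log_q by simp
  then show False using p by (simp add: Sing_contour_def)
qed

text \<open>If the point were regular, both lifts would be nondegenerate and both branches would equal the
  germ of the contour there, so they could not be distinct.\<close>

lemma two_lifts_singular:
  assumes smooth: "smooth_curve f" and qq': "(q, q') \<in> system3 f"
    and branches: "\<And>r r'. nondegenerate_lift f r \<Longrightarrow> nondegenerate_lift f r' \<Longrightarrow> r \<noteq> r' \<Longrightarrow>
        Log r = Log r' \<Longrightarrow> contour_branch f r \<noteq> contour_branch f r'"
    and degenerate: "\<And>r. r \<in> system2 f \<Longrightarrow> \<not> smooth_curve_near (contour f) (half_log (Rsq r, Ssq r))"
  shows "\<not> smooth_curve_near (contour f) (half_log (Rsq q, Ssq q))"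
proof
  assume regular: "smooth_curve_near (contour f) (half_log (Rsq q, Ssq q))"
  have crit: "crit_eqs f q" "crit_eqs f q'" and RS: "Rsq q = Rsq q'" "Ssq q = Ssq q'" and "q \<noteq> q'"
    using qq' by (auto simp: system3_def)
  have q2: "q \<notin> system2 f" "q' \<notin> system2 f"
    using degenerate[of q] degenerate[of q'] regular RS by auto
  have Log: "Log (complex_coords q) = half_log (Rsq q, Ssq q)"
    "Log (complex_coords q') = half_log (Rsq q, Ssq q)"
    using Log_eq_half_log crit_eqs_torus crit RS by metis+
  have "contour_branch f (complex_coords q) = contour_branch f (complex_coords q')"
    using contour_branch_eq_contour_germ[OF smooth crit(1) q2(1)]
      contour_branch_eq_contour_germ[OF smooth crit(2) q2(2)] regular by (simp add: Log)
  then show False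
    using branches[OF nondegenerate_off_system2[OF smooth crit(1) q2(1)]
        nondegenerate_off_system2[OF smooth crit(2) q2(2)]] Log \<open>q \<noteq> q'\<close> by simp
qed

theorem theorem5p1:
  fixes f :: laurent
  assumes smooth: "smooth_curve f"
  shows "(\<forall>p \<in> Sing_contour f. locally_proper_at f p \<and> finite (crit_fiber f p) \<longrightarrow>
            p \<in> half_log ` proj1 f \<or> p \<in> half_log ` proj2 f \<or> p \<in> half_log ` proj3 f) \<and>
         ((\<forall>p \<in> Sing_contour f. locally_proper_at f p \<and> finite (crit_fiber f p)) \<and>
          (\<forall>q q'. nondegenerate_lift f q \<and> nondegenerate_lift f q' \<and> q \<noteq> q' \<and> Log q = Log q' \<longrightarrow>
             contour_branch f q \<noteq> contour_branch f q') \<and>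
          (\<forall>(R, S) \<in> proj1 f \<union> proj2 f. \<not> smooth_curve_near (contour f) (half_log (R, S))) \<longrightarrow>
          Sing_contour f = half_log ` (proj1 f \<union> proj2 f \<union> proj3 f))"
proof (intro conjI impI)
  show "\<forall>p \<in> Sing_contour f. locally_proper_at f p \<and> finite (crit_fiber f p) \<longrightarrow>
            p \<in> half_log ` proj1 f \<or> p \<in> half_log ` proj2 f \<or> p \<in> half_log ` proj3 f"
    using singular_contour_point_in_systems[OF smooth] by blast
next
  assume "(\<forall>p \<in> Sing_contour f. locally_proper_at f p \<and> finite (crit_fiber f p)) \<and>
          (\<forall>q q'. nondegenerate_lift f q \<and> nondegenerate_lift f q' \<and> q \<noteq> q' \<and> Log q = Log q' \<longrightarrow>
             contour_branch f q \<noteq> contour_branch f q') \<and>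
          (\<forall>(R, S) \<in> proj1 f \<union> proj2 f. \<not> smooth_curve_near (contour f) (half_log (R, S)))"
  then have proper: "\<And>p. p \<in> Sing_contour f \<Longrightarrow> locally_proper_at f p"
    and branches: "\<And>q q'. nondegenerate_lift f q \<Longrightarrow> nondegenerate_lift f q' \<Longrightarrow> q \<noteq> q' \<Longrightarrow>
        Log q = Log q' \<Longrightarrow> contour_branch f q \<noteq> contour_branch f q'"
    and degenerate: "\<And>R S. (R, S) \<in> proj1 f \<union> proj2 f \<Longrightarrow> \<not> smooth_curve_near (contour f) (half_log (R, S))"
    by blast+
  show "Sing_contour f = half_log ` (proj1 f \<union> proj2 f \<union> proj3 f)"
  proof (intro equalityI subsetI)
    fix p assume "p \<in> Sing_contour f"
    then show "p \<in> half_log ` (proj1 f \<union> proj2 f \<union> proj3 f)"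
      using singular_contour_point_in_systems[OF smooth _ proper] by blast
  next
    fix p assume "p \<in> half_log ` (proj1 f \<union> proj2 f \<union> proj3 f)"
    then consider q where "q \<in> system1 f \<union> system2 f" "p = half_log (Rsq q, Ssq q)"
      | q q' where "(q, q') \<in> system3 f" "p = half_log (Rsq q, Ssq q)"
      by (auto simp: proj1_def proj2_def proj3_def)
    then show "p \<in> Sing_contour f"
    proof cases
      case 1
      then have "(Rsq q, Ssq q) \<in> proj1 f \<union> proj2 f" and crit: "crit_eqs f q"
        by (auto simp: proj1_def proj2_def system1_def system2_def)
      from degenerate[OF this(1)] show ?thesis
        using 1(2) crit contour_coords[OF smooth] by (auto simp: Sing_contour_def)
    next
      case 2
      have "\<not> smooth_curve_near (contour f) (half_log (Rsq q, Ssq q))"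
        by (rule two_lifts_singular[OF smooth 2(1) branches]) (auto intro!: degenerate simp: proj2_def)
      then show ?thesis
        using 2 contour_coords[OF smooth] by (auto simp: Sing_contour_def system3_def)
    qed
  qed
qed

end
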